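(* Let $k$, $m$ and $n$ be positive integers. Let $A_1,\ldots,A_n$ be subsets of $\mathbb{C}$ each of cardinality $k$, and for $1\leqslant i<j\leqslant n$ let $S_{ij}$ be a subset of $\mathbb{C}$ with at most $2m-1$ elements. Let $q$ be a positive odd integer and let $\zeta_1,\ldots,\zeta_n$ be distinct $q$th roots of unity. Then $$\Big|\Big\{\sum_{i=1}^n a_i:\ a_i\in A_i \text{ for all } i,\ a_i\zeta_i\neq a_j\zeta_j\ \text{and}\ a_i-a_j\notin S_{ij}\ \text{whenever}\ i<j\Big\}\Big|\geqslant (k-1-m(n-1))n+1.$$ *)

theory Defs
  imports Complex_Main
begin

end

theory Submission
  imports Defs "HOL-Library.FuncSet" "HOL-Combinatorics.Permutations"
    "HOL-Computational_Algebra.Polynomial"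
begin

text \<open>
  Put \<open>K = k - 1\<close>, \<open>d = K - m (n - 1)\<close> and \<open>N = n d\<close>, and let \<open>V\<close> be the Vandermonde product. If there were at
  most \<open>N\<close> restricted sums, the product of all \<open>\<zeta>\<^sub>j x\<^sub>j - \<zeta>\<^sub>i x\<^sub>i\<close>, all \<open>x\<^sub>j - x\<^sub>i + s\<close> and all
  \<open>x\<^sub>1 + \<dots> + x\<^sub>n - c\<close>, brought to degree \<open>n K\<close>, would vanish on \<open>A\<^sub>1 \<times> \<dots> \<times> A\<^sub>n\<close>. By the combinatorial
  Nullstellensatz (summation over the grid with the Lagrange weights) the coefficient of \<open>\<Prod> x\<^sub>i ^ K\<close> in
  its leading form \<open>V(\<zeta> x) V(x) ^ (2 m - 1) (\<Sum> x\<^sub>i) ^ N\<close> would be zero. The same coefficient is computed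
  as an average over a grid of roots of unity of large order, a discrete torus, where variables can be
  permuted freely.

  Expanding \<open>V(\<zeta> x)\<close> over permutations and using the antisymmetry of \<open>V(x)\<close>, \<open>n!\<close> times the coefficient
  is the permanent of the matrix \<open>\<zeta>\<^sub>i ^ (j - 1)\<close> times the coefficient of \<open>\<Prod> x\<^sub>i ^ K\<close> in
  \<open>V(x) ^ (2 m) (\<Sum> x\<^sub>i) ^ N\<close>. The permanent is congruent modulo 2 to the determinant \<open>V(\<zeta>)\<close>, which divides
  a power of the odd number \<open>q\<close> in the ring generated by the \<open>q\<close>th roots of unity, in which 2 is not
  a unit. The second factor is treated by Aomoto's method for Selberg integrals: integration by parts
  in one variable at a time relates the coefficient for \<open>(K, N)\<close> to that for \<open>(K - 1, N - n)\<close>, and for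
  \<open>N = 0\<close> it is, up to sign, the average of \<open>\<bar>V\<bar> ^ (2 m)\<close> over the torus, which is positive.
\<close>

section \<open>Coefficient extraction by weighted sums over grids\<close>

definition grid_sum ::
    "'i set \<Rightarrow> ('i \<Rightarrow> 'a set) \<Rightarrow> ('i \<Rightarrow> 'a \<Rightarrow> 'a) \<Rightarrow> (('i \<Rightarrow> 'a) \<Rightarrow> 'a) \<Rightarrow> 'a::comm_ring_1"
  where "grid_sum I A w f = (\<Sum>a\<in>PiE I A. (\<Prod>i\<in>I. w i (a i)) * f a)"

lemma grid_sum_add: "grid_sum I A w (\<lambda>a. f a + g a) = grid_sum I A w f + grid_sum I A w g"
  by (simp add: grid_sum_def sum.distrib algebra_simps)

lemma grid_sum_cmult: "grid_sum I A w (\<lambda>a. c * f a) = c * grid_sum I A w f"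
  by (simp add: grid_sum_def sum_distrib_left algebra_simps)

lemma grid_sum_sum: "grid_sum I A w (\<lambda>a. \<Sum>j\<in>J. f j a) = (\<Sum>j\<in>J. grid_sum I A w (f j))"
  unfolding grid_sum_def by (subst sum.swap) (simp add: sum_distrib_left)

lemma sum_PiE_insert:
  assumes "b \<notin> J"
  shows "(\<Sum>x\<in>PiE (insert b J) A. F x) = (\<Sum>x\<in>PiE J A. \<Sum>z\<in>A b. F (x(b := z)))"
proof -
  have "(\<Sum>x\<in>PiE (insert b J) A. F x) = (\<Sum>(z, x)\<in>A b \<times> PiE J A. F (x(b := z)))"
    unfolding PiE_insert_eq
    by (subst sum.reindex[OF inj_combinator[OF assms]]) (simp add: case_prod_unfold)
  also have "\<dots> = (\<Sum>z\<in>A b. \<Sum>x\<in>PiE J A. F (x(b := z)))"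
    by (simp add: sum.cartesian_product)
  finally show ?thesis by (subst sum.swap)
qed

lemma grid_sum_insert:
  assumes "finite J" "b \<notin> J"
  shows "grid_sum (insert b J) A w f = grid_sum J A w (\<lambda>x. \<Sum>z\<in>A b. w b z * f (x(b := z)))"
proof -
  have "(\<Prod>i\<in>J. w i ((x(b := z)) i)) = (\<Prod>i\<in>J. w i (x i))" for x z
    using assms by (intro prod.cong) auto
  then show ?thesis
    using assms
    by (simp add: grid_sum_def sum_PiE_insert sum_distrib_left mult_ac del: fun_upd_apply)
      (simp add: mult_ac)
qed

text \<open>
  With such weights, \<open>grid_sum I A w\<close> extracts the coefficient of \<open>\<Prod>i\<in>I. x i ^ K i\<close>
  from a polynomial of total degree at most \<open>\<Sum>i\<in>I. K i\<close>.
\<close>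

definition coeff_weights ::
    "'i set \<Rightarrow> ('i \<Rightarrow> nat) \<Rightarrow> ('i \<Rightarrow> 'a::comm_ring_1 set) \<Rightarrow> ('i \<Rightarrow> 'a \<Rightarrow> 'a) \<Rightarrow> bool"
  where "coeff_weights I K A w \<longleftrightarrow> (\<forall>i\<in>I. finite (A i) \<and>
           (\<forall>j\<le>K i. (\<Sum>x\<in>A i. w i x * x ^ j) = (if j = K i then 1 else 0)))"

lemma grid_sum_monomial:
  assumes I: "finite I" and w: "coeff_weights I K A w" and deg: "(\<Sum>i\<in>I. \<alpha> i) \<le> (\<Sum>i\<in>I. K i)"
  shows "grid_sum I A w (\<lambda>x. \<Prod>i\<in>I. x i ^ \<alpha> i) = (if \<forall>i\<in>I. \<alpha> i = K i then 1 else 0)"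
proof -
  have factors: "grid_sum I A w (\<lambda>x. \<Prod>i\<in>I. x i ^ \<alpha> i) = (\<Prod>i\<in>I. \<Sum>x\<in>A i. w i x * x ^ \<alpha> i)"
    using I w by (subst prod_sum_PiE) (auto simp: grid_sum_def coeff_weights_def prod.distrib)
  show ?thesis
  proof (cases "\<forall>i\<in>I. \<alpha> i = K i")
    case True
    then show ?thesis
      unfolding factors using w by (auto simp: coeff_weights_def intro!: prod.neutral)
  next
    case False
    have "\<exists>i\<in>I. \<alpha> i < K i"
    proof (rule ccontr)
      assume "\<not> ?thesis"
      then have ge: "\<And>i. i \<in> I \<Longrightarrow> K i \<le> \<alpha> i" by (simp add: not_less)
      then have "(\<Sum>i\<in>I. K i) = (\<Sum>i\<in>I. \<alpha> i)" using deg by (simp add: antisym sum_mono)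
      from sum_mono_inv[OF this ge _ I] False show False by fastforce
    qed
    then obtain i where i: "i \<in> I" "\<alpha> i < K i" by blast
    then have "(\<Sum>x\<in>A i. w i x * x ^ \<alpha> i) = 0"
      using w by (auto simp: coeff_weights_def)
    with i I False show ?thesis unfolding factors by (auto intro: prod_zero)
  qed
qed

text \<open>
  \<open>has_leading_form I d f g\<close>: the function \<open>f\<close> is given by a polynomial of total degree at most \<open>d\<close>
  in the variables indexed by \<open>I\<close>, and \<open>g\<close> by its homogeneous component of degree \<open>d\<close>.
\<close>

inductive has_leading_form ::
    "'i set \<Rightarrow> nat \<Rightarrow> (('i \<Rightarrow> 'a) \<Rightarrow> 'a) \<Rightarrow> (('i \<Rightarrow> 'a) \<Rightarrow> 'a::comm_ring_1) \<Rightarrow> bool"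
  for I d where
  monomial: "(\<Sum>i\<in>I. \<alpha> i) \<le> d \<Longrightarrow> has_leading_form I d (\<lambda>x. c * (\<Prod>i\<in>I. x i ^ \<alpha> i))
    (\<lambda>x. if (\<Sum>i\<in>I. \<alpha> i) = d then c * (\<Prod>i\<in>I. x i ^ \<alpha> i) else 0)"
| add: "has_leading_form I d f g \<Longrightarrow> has_leading_form I d f' g' \<Longrightarrow>
    has_leading_form I d (\<lambda>x. f x + f' x) (\<lambda>x. g x + g' x)"

lemma has_leading_form_const:
  "has_leading_form I d (\<lambda>_. c) (\<lambda>_. if d = 0 then c else 0)"
  using has_leading_form.monomial[of "\<lambda>_. 0" I d c] by (simp add: eq_commute[of 0] cong: if_cong)

lemma has_leading_form_var:
  assumes "finite I" "i \<in> I"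
  shows "has_leading_form I 1 (\<lambda>x. c * x i) (\<lambda>x. c * x i)"
  using has_leading_form.monomial[of "\<lambda>j. if j = i then 1 else 0" I 1 c] assms
  by (simp add: if_distrib[of "\<lambda>k. _ ^ k"] cong: if_cong)

lemma has_leading_form_mult_monomial:
  assumes \<alpha>: "(\<Sum>i\<in>I. \<alpha> i) \<le> d" and f: "has_leading_form I e f g"
  shows "has_leading_form I (d + e) (\<lambda>x. c * (\<Prod>i\<in>I. x i ^ \<alpha> i) * f x)
    (\<lambda>x. (if (\<Sum>i\<in>I. \<alpha> i) = d then c * (\<Prod>i\<in>I. x i ^ \<alpha> i) else 0) * g x)"
  using f
proof induction
  case (monomial \<beta> b)
  have deg: "(\<Sum>i\<in>I. \<alpha> i) + (\<Sum>i\<in>I. \<beta> i) = d + e \<longleftrightarrow> (\<Sum>i\<in>I. \<alpha> i) = d \<and> (\<Sum>i\<in>I. \<beta> i) = e"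
    using \<alpha> monomial by linarith
  have prod: "c * (\<Prod>i\<in>I. x i ^ \<alpha> i) * (b * (\<Prod>i\<in>I. x i ^ \<beta> i)) =
      c * b * (\<Prod>i\<in>I. x i ^ (\<alpha> i + \<beta> i))" for x
    by (simp add: power_add prod.distrib algebra_simps)
  have top: "(if (\<Sum>i\<in>I. \<alpha> i) = d then c * (\<Prod>i\<in>I. x i ^ \<alpha> i) else 0) *
      (if (\<Sum>i\<in>I. \<beta> i) = e then b * (\<Prod>i\<in>I. x i ^ \<beta> i) else 0) =
      (if (\<Sum>i\<in>I. \<alpha> i + \<beta> i) = d + e then c * b * (\<Prod>i\<in>I. x i ^ (\<alpha> i + \<beta> i)) else 0)" for x
    unfolding sum.distrib deg prod[symmetric] by simp
  have "(\<Sum>i\<in>I. \<alpha> i + \<beta> i) \<le> d + e"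
    using \<alpha> monomial by (simp add: sum.distrib)
  then show ?case unfolding prod top by (rule has_leading_form.monomial)
next
  case (add f g f' g')
  then show ?case by (simp only: distrib_left has_leading_form.add)
qed

lemma has_leading_form_mult:
  assumes "has_leading_form I d f g" "has_leading_form I e f' g'"
  shows "has_leading_form I (d + e) (\<lambda>x. f x * f' x) (\<lambda>x. g x * g' x)"
  using assms(1)
proof induction
  case (monomial \<alpha> c)
  then show ?case using assms(2) by (rule has_leading_form_mult_monomial)
next
  case (add f g f' g')
  then show ?case by (simp only: distrib_right has_leading_form.add)
qed

lemma has_leading_form_prod:
  assumes "finite T" "\<And>t. t \<in> T \<Longrightarrow> has_leading_form I (d t) (f t) (g t)"
  shows "has_leading_form I (\<Sum>t\<in>T. d t) (\<lambda>x. \<Prod>t\<in>T. f t x) (\<lambda>x. \<Prod>t\<in>T. g t x)"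
  using assms
proof (induction T rule: finite_induct)
  case empty
  show ?case using has_leading_form_const[of I 0 1] by simp
next
  case (insert t T)
  then show ?case by (simp add: has_leading_form_mult)
qed

lemma has_leading_form_power:
  assumes "has_leading_form I d f g"
  shows "has_leading_form I (e * d) (\<lambda>x. f x ^ e) (\<lambda>x. g x ^ e)"
  using has_leading_form_prod[of "{..<e}" I "\<lambda>_. d" "\<lambda>_. f" "\<lambda>_. g"] assms by simp

lemma has_leading_form_sum_vars:
  assumes "finite I"
  shows "has_leading_form I 1 (\<lambda>x. \<Sum>i\<in>I. x i) (\<lambda>x. \<Sum>i\<in>I. x i)"
proof -
  have "has_leading_form I 1 (\<lambda>x. \<Sum>i\<in>J. x i) (\<lambda>x. \<Sum>i\<in>J. x i)" if "finite J" "J \<subseteq> I" for J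
    using that
  proof (induction J rule: finite_induct)
    case empty
    show ?case using has_leading_form_const[of I 1 0] by simp
  next
    case (insert i J)
    then show ?case
      using has_leading_form.add[OF has_leading_form_var[OF assms, of i 1]] by simp
  qed
  then show ?thesis using assms by blast
qed

lemma has_leading_form_add_const:
  assumes "has_leading_form I d f g" "d > 0"
  shows "has_leading_form I d (\<lambda>x. f x + c) g"
  using has_leading_form.add[OF assms(1) has_leading_form_const[of I d c]] assms(2) by simp

lemma has_leading_form_diff_vars:
  assumes "finite I" "i \<in> I" "j \<in> I"
  shows "has_leading_form I 1 (\<lambda>x. u * x i - v * x j) (\<lambda>x. u * x i - v * x j)"
  using has_leading_form.add[OF has_leading_form_var[OF assms(1,2), of u]
      has_leading_form_var[OF assms(1,3), of "- v"]] by simp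

lemma grid_sum_leading_form:
  assumes "has_leading_form I (\<Sum>i\<in>I. K i) f g" "finite I"
    and "coeff_weights I K A w" "coeff_weights I K B v"
  shows "grid_sum I A w f = grid_sum I B v g"
  using assms(1)
proof induction
  case (monomial \<alpha> c)
  note monomial_sums = grid_sum_monomial[OF assms(2,3) monomial]
    grid_sum_monomial[OF assms(2,4) monomial]
  show ?case
  proof (cases "(\<Sum>i\<in>I. \<alpha> i) = (\<Sum>i\<in>I. K i)")
    case True
    then show ?thesis by (simp only: True refl if_True grid_sum_cmult monomial_sums)
  next
    case False
    then have "\<not> (\<forall>i\<in>I. \<alpha> i = K i)" by (metis sum.cong)
    with False show ?thesis
      using grid_sum_cmult[of I B v 0] by (auto simp: grid_sum_cmult monomial_sums)
  qed
next
  case (add f g f' g')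
  then show ?case by (simp add: grid_sum_add)
qed

section \<open>The combinatorial Nullstellensatz and the polynomial method\<close>

lemma sum_lagrange_weights_poly:
  fixes p :: "'a::field poly"
  assumes X: "finite X" "card X = Suc K" and p: "degree p \<le> K"
  shows "(\<Sum>x\<in>X. poly p x / (\<Prod>y\<in>X - {x}. x - y)) = coeff p K"
proof -
  define L where "L x = (\<Prod>y\<in>X - {x}. [:- y, 1:])" for x
  define Q where "Q = (\<Sum>x\<in>X. smult (poly p x / (\<Prod>y\<in>X - {x}. x - y)) (L x))"
  have degL: "degree (L x) = K" if "x \<in> X" for x
    using X that by (simp add: L_def degree_prod_eq_sum_degree)
  moreover have "lead_coeff (L x) = 1" for x
    unfolding L_def lead_coeff_prod by simp
  ultimately have coeffL: "coeff (L x) K = 1" if "x \<in> X" for x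
    using that by metis
  have "p = Q"
  proof (rule poly_eqI_degree[where A = X])
    have "degree Q \<le> K"
      unfolding Q_def
      by (rule degree_sum_le) (use X degL in \<open>auto intro: order_trans[OF degree_smult_le]\<close>)
    then show "card X > degree Q" and "card X > degree p" using X p by simp_all
  next
    fix z assume z: "z \<in> X"
    have "poly (L x) z = 0" if "x \<in> X" "x \<noteq> z" for x
      using that z X unfolding L_def by (auto simp: poly_prod intro!: prod_zero)
    then have "poly Q z =
        (\<Sum>x\<in>X. if x = z then poly p z / (\<Prod>y\<in>X - {z}. z - y) * poly (L z) z else 0)"
      unfolding Q_def poly_sum by (intro sum.cong) auto
    also have "\<dots> = poly p z"
      using z X by (simp add: L_def poly_prod)
    finally show "poly p z = poly Q z" by simp
  qed
  then have "coeff p K = coeff Q K" by simp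
  also have "\<dots> = (\<Sum>x\<in>X. poly p x / (\<Prod>y\<in>X - {x}. x - y))"
    using coeffL by (simp add: Q_def coeff_sum)
  finally show ?thesis by simp
qed

lemma coeff_weights_lagrange:
  fixes A :: "'i \<Rightarrow> 'a::field set"
  assumes "\<And>i. i \<in> I \<Longrightarrow> finite (A i) \<and> card (A i) = Suc (K i)"
  shows "coeff_weights I K A (\<lambda>i x. 1 / (\<Prod>y\<in>A i - {x}. x - y))"
  unfolding coeff_weights_def
proof (intro ballI conjI allI impI)
  fix i j assume i: "i \<in> I" and j: "j \<le> K i"
  have "degree (monom (1::'a) j) \<le> K i" using j degree_monom_le le_trans by blast
  from sum_lagrange_weights_poly[OF _ _ this] assms[OF i]
  show "(\<Sum>x\<in>A i. 1 / (\<Prod>y\<in>A i - {x}. x - y) * x ^ j) = (if j = K i then 1 else 0)"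
    by (simp add: poly_monom)
qed (use assms in blast)

theorem combinatorial_nullstellensatz:
  fixes A :: "'i \<Rightarrow> 'a::field set"
  assumes I: "finite I" and A: "\<And>i. i \<in> I \<Longrightarrow> finite (A i) \<and> card (A i) = Suc (K i)"
    and f: "has_leading_form I (\<Sum>i\<in>I. K i) f g"
    and B: "coeff_weights I K B v" and nonzero: "grid_sum I B v g \<noteq> 0"
  obtains a where "a \<in> PiE I A" "f a \<noteq> 0"
proof -
  have "grid_sum I A (\<lambda>i x. 1 / (\<Prod>y\<in>A i - {x}. x - y)) f \<noteq> 0"
    using grid_sum_leading_form[OF f I coeff_weights_lagrange[OF A] B] nonzero by simp
  then show ?thesis
    unfolding grid_sum_def using that by (metis (lifting) mult_zero_right sum.neutral)
qed

theorem polynomial_method_card_sums: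
  fixes A :: "'i \<Rightarrow> 'a::field set"
  assumes I: "finite I" and A: "\<And>i. i \<in> I \<Longrightarrow> finite (A i) \<and> card (A i) = Suc (K i)"
    and f: "has_leading_form I d f g" and deg: "d + N = (\<Sum>i\<in>I. K i)"
    and B: "coeff_weights I K B v"
    and nonzero: "grid_sum I B v (\<lambda>x. g x * (\<Sum>i\<in>I. x i) ^ N) \<noteq> 0"
  shows "N < card ((\<lambda>a. \<Sum>i\<in>I. a i) ` {a \<in> PiE I A. f a \<noteq> 0})"
proof (rule ccontr)
  define X where "X = (\<lambda>a. \<Sum>i\<in>I. a i) ` {a \<in> PiE I A. f a \<noteq> 0}"
  assume "\<not> ?thesis"
  then have le: "card X \<le> N" by (simp add: X_def)
  have "finite (PiE I A)" using I A by (intro finite_PiE) auto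
  then have X: "finite X" by (simp add: X_def del: PiE_iff)
  define h where "h x = f x * ((\<Sum>i\<in>I. x i) ^ (N - card X) * (\<Prod>c\<in>X. (\<Sum>i\<in>I. x i) - c))" for x
  have "has_leading_form I 1 (\<lambda>x. (\<Sum>i\<in>I. x i) - c) (\<lambda>x. \<Sum>i\<in>I. x i)" for c :: 'a
    using has_leading_form_add_const[OF has_leading_form_sum_vars[OF I], of "- c"] by simp
  then have "has_leading_form I (\<Sum>c\<in>X. 1) (\<lambda>x. \<Prod>c\<in>X. (\<Sum>i\<in>I. x i) - c)
      (\<lambda>x. \<Prod>c\<in>X. \<Sum>i\<in>I. x i)"
    by (rule has_leading_form_prod[OF X])
  from has_leading_form_mult[OF f has_leading_form_mult[OF
      has_leading_form_power[OF has_leading_form_sum_vars[OF I], of "N - card X"] this]]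
  have "has_leading_form I (d + ((N - card X) * 1 + (\<Sum>c\<in>X. 1))) h
      (\<lambda>x. g x * ((\<Sum>i\<in>I. x i) ^ (N - card X) * (\<Prod>c\<in>X. \<Sum>i\<in>I. x i)))"
    unfolding h_def .
  then have "has_leading_form I (\<Sum>i\<in>I. K i) h (\<lambda>x. g x * (\<Sum>i\<in>I. x i) ^ N)"
    using le by (simp add: deg power_add[symmetric])
  from combinatorial_nullstellensatz[OF I A this B nonzero]
  obtain a where a: "a \<in> PiE I A" "h a \<noteq> 0" by blast
  then have "f a \<noteq> 0" "(\<Prod>c\<in>X. (\<Sum>i\<in>I. a i) - c) \<noteq> 0" by (auto simp: h_def)
  then have "f a \<noteq> 0" "(\<Sum>i\<in>I. a i) \<notin> X" using X by auto
  with a(1) show False by (auto simp: X_def)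
qed

section \<open>Integer combinations of roots of unity\<close>

text \<open>
  For prime \<open>p\<close>, the hypothesis says that the additive group generated by \<open>X\<close> becomes \<open>p\<close>-divisible
  after localisation at \<open>p\<close>.
\<close>

lemma nakayama_int:
  fixes X :: "'a::{idom, ring_char_0} set" and p :: int
  assumes p: "\<not> is_unit p" and "finite X"
    and "\<And>x. x \<in> X \<Longrightarrow> \<exists>b c. coprime b p \<and> of_int b * x = of_int p * (\<Sum>y\<in>X. of_int (c y) * y)"
    and "x \<in> X"
  shows "x = 0"
  using assms(2-4)
proof (induction X arbitrary: x rule: finite_induct)
  case (insert v X)
  obtain b\<^sub>0 c where b\<^sub>0: "coprime b\<^sub>0 p" "of_int b\<^sub>0 * v = of_int p * (\<Sum>y\<in>insert v X. of_int (c y) * y)"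
    using insert.prems(1)[of v] by blast
  define b where "b = - c v * p + b\<^sub>0"
  have "coprime p b"
    using b\<^sub>0(1) by (simp only: b_def coprime_iff_gcd_eq_1 gcd_add_mult gcd.commute)
  then have b: "coprime b p" "of_int b * v = of_int p * (\<Sum>y\<in>X. of_int (c y) * y)"
    using b\<^sub>0(2) insert.hyps by (auto simp: b_def algebra_simps coprime_commute)
  have X_zero: "x = 0" if "x \<in> X" for x
  proof (rule insert.IH[OF _ that])
    fix x assume "x \<in> X"
    then obtain e d
      where e: "coprime e p" "of_int e * x = of_int p * (\<Sum>y\<in>insert v X. of_int (d y) * y)"
      using insert.prems(1)[of x] by blast
    have "of_int (b * e) * x = of_int b * (of_int p * (of_int (d v) * v + (\<Sum>y\<in>X. of_int (d y) * y)))"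
      using e insert.hyps by simp
    also have "\<dots> = of_int p * (of_int (d v) * (of_int b * v) + (\<Sum>y\<in>X. of_int (b * d y) * y))"
      by (simp add: algebra_simps sum_distrib_left)
    also have "\<dots> = of_int p * (\<Sum>y\<in>X. of_int (b * d y + p * d v * c y) * y)"
      unfolding b by (simp add: algebra_simps sum_distrib_left sum.distrib)
    finally show "\<exists>b c. coprime b p \<and> of_int b * x = of_int p * (\<Sum>y\<in>X. of_int (c y) * y)"
      using b e by (intro exI[of _ "b * e"] exI[of _ "\<lambda>y. b * d y + p * d v * c y"]) simp
  qed
  then have "of_int b * v = 0" unfolding b by (simp add: sum.neutral)
  moreover have "b \<noteq> 0" using b(1) p by auto
  ultimately show ?case using X_zero insert.prems(2) by auto
qed simp

definition cyclotomic_ints :: "nat \<Rightarrow> complex set"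
  where "cyclotomic_ints q = range (\<lambda>c. \<Sum>y | y ^ q = 1. of_int (c y) * y)"

lemma cyclotomic_intsI:
  "x = (\<Sum>y | y ^ q = 1. of_int (c y) * y) \<Longrightarrow> x \<in> cyclotomic_ints q"
  unfolding cyclotomic_ints_def by (rule range_eqI[of _ _ c])

lemma cyclotomic_intsE:
  assumes "x \<in> cyclotomic_ints q"
  obtains c where "x = (\<Sum>y | y ^ q = 1. of_int (c y) * y)"
  using assms unfolding cyclotomic_ints_def by blast

lemma cyclotomic_ints_0: "0 \<in> cyclotomic_ints q"
  by (rule cyclotomic_intsI[where c = "\<lambda>_. 0"]) simp

lemma cyclotomic_ints_add:
  assumes "x \<in> cyclotomic_ints q" "y \<in> cyclotomic_ints q"
  shows "x + y \<in> cyclotomic_ints q"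
proof -
  obtain c d where "x = (\<Sum>y | y ^ q = 1. of_int (c y) * y)"
    "y = (\<Sum>y | y ^ q = 1. of_int (d y) * y)"
    using assms by (elim cyclotomic_intsE)
  then have "x + y = (\<Sum>y | y ^ q = 1. of_int (c y + d y) * y)"
    by (simp add: sum.distrib algebra_simps)
  then show ?thesis by (rule cyclotomic_intsI)
qed

lemma cyclotomic_ints_of_int_mult:
  assumes "x \<in> cyclotomic_ints q"
  shows "of_int a * x \<in> cyclotomic_ints q"
proof -
  obtain c where "x = (\<Sum>y | y ^ q = 1. of_int (c y) * y)"
    using assms by (elim cyclotomic_intsE)
  then have "of_int a * x = (\<Sum>y | y ^ q = 1. of_int (a * c y) * y)"
    by (simp add: sum_distrib_left algebra_simps)
  then show ?thesis by (rule cyclotomic_intsI)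
qed

lemma cyclotomic_ints_sum:
  "(\<And>t. t \<in> T \<Longrightarrow> f t \<in> cyclotomic_ints q) \<Longrightarrow> (\<Sum>t\<in>T. f t) \<in> cyclotomic_ints q"
  by (induction T rule: infinite_finite_induct) (auto intro: cyclotomic_ints_add cyclotomic_ints_0)

definition cyclotomic_odd_divisors :: "nat \<Rightarrow> complex set"
  where "cyclotomic_odd_divisors q =
    {x. \<exists>u\<in>cyclotomic_ints q. \<exists>a::int. odd a \<and> x * u = of_int a}"

lemma cyclotomic_ints_root:
  assumes q: "q > 0" and "z ^ q = 1"
  shows "z \<in> cyclotomic_ints q"
proof -
  have "z = (\<Sum>y | y ^ q = 1. if y = z then y else 0)"
    using assms q by (simp add: finite_nth_roots)
  also have "\<dots> = (\<Sum>y | y ^ q = 1. of_int (if y = z then 1 else 0) * y)"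
    by (rule sum.cong) auto
  finally show ?thesis by (rule cyclotomic_intsI)
qed

lemma cyclotomic_ints_1: "q > 0 \<Longrightarrow> 1 \<in> cyclotomic_ints q"
  by (rule cyclotomic_ints_root) simp_all

lemma cyclotomic_ints_mult:
  assumes q: "q > 0" and "x \<in> cyclotomic_ints q" "y \<in> cyclotomic_ints q"
  shows "x * y \<in> cyclotomic_ints q"
proof -
  obtain c d where "x = (\<Sum>y | y ^ q = 1. of_int (c y) * y)"
    "y = (\<Sum>y | y ^ q = 1. of_int (d y) * y)"
    using assms by (elim cyclotomic_intsE)
  then have "x * y = (\<Sum>u | u ^ q = 1. \<Sum>v | v ^ q = 1. of_int (c u * d v) * (u * v))"
    by (simp add: sum_product algebra_simps)
  also have "\<dots> \<in> cyclotomic_ints q"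
    by (intro cyclotomic_ints_sum cyclotomic_ints_of_int_mult cyclotomic_ints_root q)
       (auto simp: power_mult_distrib)
  finally show ?thesis .
qed

lemma cyclotomic_ints_prod:
  assumes "q > 0" "\<And>t. t \<in> T \<Longrightarrow> f t \<in> cyclotomic_ints q"
  shows "(\<Prod>t\<in>T. f t) \<in> cyclotomic_ints q"
  using assms(2)
  by (induction T rule: infinite_finite_induct)
    (auto intro: cyclotomic_ints_mult cyclotomic_ints_1 assms(1))

lemma coprime_neq_mult_cyclotomic_int:
  fixes p :: int
  assumes q: "q > 0" and p: "\<not> is_unit p" and a: "coprime a p" and x: "x \<in> cyclotomic_ints q"
  shows "of_int a \<noteq> of_int p * x"
proof
  assume eq: "of_int a = of_int p * x"
  have "\<exists>b c. coprime b p \<and> of_int b * z = of_int p * (\<Sum>y | y ^ q = 1. of_int (c y) * y)"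
    if "z \<in> {y. y ^ q = 1}" for z :: complex
  proof -
    have "x * z \<in> cyclotomic_ints q"
      using that by (intro cyclotomic_ints_mult x cyclotomic_ints_root q) simp
    then obtain c where "x * z = (\<Sum>y | y ^ q = 1. of_int (c y) * y)"
      by (elim cyclotomic_intsE)
    then have "of_int a * z = of_int p * (\<Sum>y | y ^ q = 1. of_int (c y) * y)"
      unfolding eq by (simp add: mult.assoc)
    with a show ?thesis by blast
  qed
  from nakayama_int[OF p finite_nth_roots[OF q] this, of 1] show False by simp
qed

lemma roots_of_unity_diff_dvd_order:
  assumes q: "q > 0" and "x ^ q = 1" "y ^ q = 1" "x \<noteq> y"
  obtains u where "u \<in> cyclotomic_ints q" "(x - y) * u = of_nat q"
proof -
  have nz: "x \<noteq> 0" using assms by (auto simp: power_0_left split: if_splits)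
  define r where "r = y / x"
  have r: "r ^ q = 1" "r \<noteq> 1" using assms nz by (auto simp: r_def power_divide)
  define u where "u = (\<Sum>i<q. \<Sum>j<i. r ^ j)"
  have "(1 - r) * (\<Sum>i<q. r ^ i) = 0" using r by (simp add: one_diff_power_eq[symmetric])
  then have "(\<Sum>i<q. r ^ i) = 0" using r by simp
  then have "of_nat q = (\<Sum>i<q. 1 - r ^ i)" by (simp add: sum_subtractf)
  also have "\<dots> = (1 - r) * u" by (simp add: one_diff_power_eq u_def sum_distrib_left)
  also have "\<dots> = (x - y) * (1 / x * u)" using nz by (simp add: r_def field_simps)
  finally have "(x - y) * (1 / x * u) = of_nat q" by simp
  moreover have "1 / x * u \<in> cyclotomic_ints q"
  proof -
    have "(1 / x) ^ q = 1" using assms by (simp add: power_divide)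
    moreover have "(r ^ j) ^ q = 1" for j using r by (metis power_mult mult.commute power_one)
    ultimately show ?thesis
      unfolding u_def by (intro cyclotomic_ints_mult cyclotomic_ints_sum cyclotomic_ints_root q)
  qed
  ultimately show ?thesis using that by blast
qed

lemma cyclotomic_odd_divisors_mult:
  assumes "q > 0" and "x \<in> cyclotomic_odd_divisors q" "y \<in> cyclotomic_odd_divisors q"
  shows "x * y \<in> cyclotomic_odd_divisors q"
proof -
  obtain u v and a b :: int where u: "u \<in> cyclotomic_ints q" "odd a" "x * u = of_int a"
    and v: "v \<in> cyclotomic_ints q" "odd b" "y * v = of_int b"
    using assms(2,3) unfolding cyclotomic_odd_divisors_def by blast
  have "x * y * (u * v) = (x * u) * (y * v)" by (simp only: mult_ac)
  then have "x * y * (u * v) = of_int (a * b)" unfolding u v by simp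
  moreover have "u * v \<in> cyclotomic_ints q" "odd (a * b)"
    using u v by (simp_all add: cyclotomic_ints_mult[OF assms(1)])
  ultimately show ?thesis unfolding cyclotomic_odd_divisors_def by blast
qed

lemma cyclotomic_odd_divisors_prod:
  assumes "q > 0" "\<And>t. t \<in> T \<Longrightarrow> f t \<in> cyclotomic_odd_divisors q"
  shows "(\<Prod>t\<in>T. f t) \<in> cyclotomic_odd_divisors q"
  using assms(2)
proof (induction T rule: infinite_finite_induct)
  case (insert t T)
  then show ?case by (simp add: cyclotomic_odd_divisors_mult[OF assms(1)])
qed (use cyclotomic_ints_1[OF assms(1)] in
    \<open>auto simp: cyclotomic_odd_divisors_def intro!: bexI[of _ 1] exI[of _ 1]\<close>)

lemma roots_of_unity_diff_odd_divisor:
  assumes "odd q" "x ^ q = 1" "y ^ q = 1" "x \<noteq> y"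
  shows "x - y \<in> cyclotomic_odd_divisors q"
proof -
  obtain u where "u \<in> cyclotomic_ints q" "(x - y) * u = of_int (int q)"
    using roots_of_unity_diff_dvd_order[OF odd_pos[OF assms(1)] assms(2-4)] by auto
  moreover have "odd (int q)" using \<open>odd q\<close> by simp
  ultimately show ?thesis unfolding cyclotomic_odd_divisors_def by blast
qed

lemma twice_cyclotomic_int_not_odd_divisor:
  assumes "q > 0" "x \<in> cyclotomic_ints q"
  shows "2 * x \<notin> cyclotomic_odd_divisors q"
proof
  assume "2 * x \<in> cyclotomic_odd_divisors q"
  then obtain u and a :: int where "u \<in> cyclotomic_ints q" "odd a" "2 * x * u = of_int a"
    unfolding cyclotomic_odd_divisors_def by blast
  then show False
    using coprime_neq_mult_cyclotomic_int[OF assms(1), of 2 a "x * u"]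
      cyclotomic_ints_mult[OF assms, of u]
    by (simp add: mult.assoc)
qed

section \<open>Vandermonde products and alternants\<close>

definition vandermonde :: "nat \<Rightarrow> (nat \<Rightarrow> 'a) \<Rightarrow> 'a::comm_ring_1"
  where "vandermonde n y = (\<Prod>j\<in>{1..n}. \<Prod>i\<in>{1..<j}. y j - y i)"

definition alternant :: "nat \<Rightarrow> (nat \<Rightarrow> 'a) \<Rightarrow> 'a::comm_ring_1"
  where "alternant n y =
    (\<Sum>\<sigma> | \<sigma> permutes {1..n}. of_int (sign \<sigma>) * (\<Prod>i\<in>{1..n}. y i ^ (\<sigma> i - 1)))"

lemma vandermonde_Suc: "vandermonde (Suc n) y = vandermonde n y * (\<Prod>i\<in>{1..n}. y (Suc n) - y i)"
  by (simp add: vandermonde_def prod.nat_ivl_Suc' atLeastLessThanSuc_atLeastAtMost mult.commute)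

lemma vandermonde_eq_0:
  assumes "a \<in> {1..n}" "b \<in> {1..n}" "a \<noteq> b" "y a = y b"
  shows "vandermonde n y = 0"
  using assms
proof (induction a b rule: linorder_less_wlog)
  case (less a b)
  then have "(\<Prod>i\<in>{1..<b}. y b - y i) = 0" by (intro prod_zero bexI[of _ a]) auto
  then show ?case using less unfolding vandermonde_def by (intro prod_zero) auto
qed auto

lemma alternant_permute:
  assumes \<tau>: "\<tau> permutes {1..n}"
  shows "alternant n (y \<circ> \<tau>) = of_int (sign \<tau>) * alternant n y"
proof -
  have "alternant n (y \<circ> \<tau>) = (\<Sum>\<sigma> | \<sigma> permutes {1..n}. of_int (sign (\<sigma> \<circ> \<tau>)) *
      (\<Prod>i\<in>{1..n}. (y \<circ> \<tau>) i ^ ((\<sigma> \<circ> \<tau>) i - 1)))"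
    unfolding alternant_def by (rule sum_permutations_compose_right[OF \<tau>])
  also have "\<dots> = (\<Sum>\<sigma> | \<sigma> permutes {1..n}. of_int (sign \<tau>) *
      (of_int (sign \<sigma>) * (\<Prod>i\<in>{1..n}. y i ^ (\<sigma> i - 1))))"
  proof (rule sum.cong[OF refl])
    fix \<sigma> assume "\<sigma> \<in> {\<sigma>. \<sigma> permutes {1..n}}"
    then have "sign (\<sigma> \<circ> \<tau>) = sign \<sigma> * sign \<tau>"
      using \<tau> by (auto intro!: sign_compose permutes_imp_permutation[of "{1..n}"])
    then show "of_int (sign (\<sigma> \<circ> \<tau>)) * (\<Prod>i\<in>{1..n}. (y \<circ> \<tau>) i ^ ((\<sigma> \<circ> \<tau>) i - 1)) =
      of_int (sign \<tau>) * (of_int (sign \<sigma>) * (\<Prod>i\<in>{1..n}. y i ^ (\<sigma> i - 1)))"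
      using prod.permute[OF \<tau>, of "\<lambda>i. y i ^ (\<sigma> i - 1)"] by (simp add: o_def)
  qed
  finally show ?thesis by (simp add: alternant_def sum_distrib_left)
qed

lemma alternant_eq_0:
  fixes y :: "nat \<Rightarrow> 'a::{idom, ring_char_0}"
  assumes "a \<in> {1..n}" "b \<in> {1..n}" "a \<noteq> b" "y a = y b"
  shows "alternant n y = 0"
proof -
  have "y \<circ> transpose a b = y" using assms by (auto simp: transpose_def)
  with alternant_permute[OF permutes_swap_id[OF assms(1,2)], of y] assms(3) show ?thesis
    by (simp add: sign_swap_id)
qed

definition alternant_poly :: "nat \<Rightarrow> (nat \<Rightarrow> 'a) \<Rightarrow> 'a::comm_ring_1 poly"
  where "alternant_poly n y = (\<Sum>\<sigma> | \<sigma> permutes {1..Suc n}.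
    monom (of_int (sign \<sigma>) * (\<Prod>i\<in>{1..n}. y i ^ (\<sigma> i - 1))) (\<sigma> (Suc n) - 1))"

lemma poly_alternant_poly: "poly (alternant_poly n y) t = alternant (Suc n) (y(Suc n := t))"
  by (simp add: alternant_poly_def alternant_def poly_sum poly_monom mult.assoc)

lemma degree_alternant_poly_le: "degree (alternant_poly n y) \<le> n"
  unfolding alternant_poly_def
proof (rule degree_sum_le)
  fix \<sigma> assume "\<sigma> \<in> {\<sigma>. \<sigma> permutes {1..Suc n}}"
  then have "\<sigma> (Suc n) - 1 \<le> n" using permutes_in_image[of \<sigma> "{1..Suc n}" "Suc n"] by auto
  with degree_monom_le
  show "degree (monom (of_int (sign \<sigma>) * (\<Prod>i\<in>{1..n}. y i ^ (\<sigma> i - 1))) (\<sigma> (Suc n) - 1)) \<le> n"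
    by (rule order_trans)
qed (simp add: finite_permutations)

lemma permutes_Suc_fixed:
  "{\<sigma>. \<sigma> permutes {1..Suc n} \<and> \<sigma> (Suc n) = Suc n} = {\<sigma>. \<sigma> permutes {1..n}}"
proof safe
  fix \<sigma> assume \<sigma>: "\<sigma> permutes {1..Suc n}" and fixed: "\<sigma> (Suc n) = Suc n"
  show "\<sigma> permutes {1..n}"
    by (rule permutes_superset[OF \<sigma>]) (use fixed in \<open>auto simp: le_Suc_eq\<close>)
next
  fix \<sigma> assume \<sigma>: "\<sigma> permutes {1..n}"
  show "\<sigma> permutes {1..Suc n}" by (rule permutes_subset[OF \<sigma>]) auto
  show "\<sigma> (Suc n) = Suc n" by (rule permutes_not_in[OF \<sigma>]) auto
qed

lemma coeff_alternant_poly: "coeff (alternant_poly n y) n = alternant n y"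
proof -
  let ?term = "\<lambda>\<sigma>. of_int (sign \<sigma>) * (\<Prod>i\<in>{1..n}. y i ^ (\<sigma> i - 1))"
  have "coeff (alternant_poly n y) n =
    (\<Sum>\<sigma> | \<sigma> permutes {1..Suc n}. if \<sigma> (Suc n) = Suc n then ?term \<sigma> else 0)"
    unfolding alternant_poly_def coeff_sum
  proof (intro sum.cong refl)
    fix \<sigma> assume "\<sigma> \<in> {\<sigma>. \<sigma> permutes {1..Suc n}}"
    then have "\<sigma> (Suc n) \<in> {1..Suc n}" using permutes_in_image[of \<sigma> "{1..Suc n}" "Suc n"] by simp
    then have "\<sigma> (Suc n) - 1 = n \<longleftrightarrow> \<sigma> (Suc n) = Suc n" by auto
    then show "coeff (monom (?term \<sigma>) (\<sigma> (Suc n) - 1)) n = (if \<sigma> (Suc n) = Suc n then ?term \<sigma> else 0)"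
      by simp
  qed
  also have "\<dots> = (\<Sum>\<sigma> | \<sigma> permutes {1..Suc n} \<and> \<sigma> (Suc n) = Suc n. ?term \<sigma>)"
    by (rule sum.mono_neutral_cong_right) (auto simp: finite_permutations)
  finally show ?thesis unfolding permutes_Suc_fixed alternant_def .
qed

lemma alternant_poly_eq:
  fixes y :: "nat \<Rightarrow> 'a::{idom, ring_char_0}"
  assumes "inj_on y {1..n}"
  shows "alternant_poly n y = smult (alternant n y) (\<Prod>i\<in>{1..n}. [:- y i, 1:])"
proof (rule poly_eqI_degree_lead_coeff[where A = "y ` {1..n}"])
  have deg: "degree (\<Prod>i\<in>{1..n}. [:- y i, 1:]) = n"
    by (simp add: degree_prod_eq_sum_degree)
  then show "degree (smult (alternant n y) (\<Prod>i\<in>{1..n}. [:- y i, 1:])) \<le> n"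
    by (metis degree_smult_le)
  have "coeff (\<Prod>i\<in>{1..n}. [:- y i, 1:]) n = 1"
    using lead_coeff_prod[of "\<lambda>i. [:- y i, 1:]" "{1..n}"] deg by simp
  then show "coeff (alternant_poly n y) n =
      coeff (smult (alternant n y) (\<Prod>i\<in>{1..n}. [:- y i, 1:])) n"
    by (simp add: coeff_alternant_poly)
  show "n \<le> card (y ` {1..n})" using assms by (simp add: card_image)
next
  fix z assume "z \<in> y ` {1..n}"
  then obtain a where a: "a \<in> {1..n}" "z = y a" by auto
  have "alternant (Suc n) (y(Suc n := z)) = 0"
    using a by (intro alternant_eq_0[of a _ "Suc n"]) auto
  moreover have "poly (\<Prod>i\<in>{1..n}. [:- y i, 1:]) z = 0"
    using a by (auto simp: poly_prod intro!: prod_zero)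
  ultimately show "poly (alternant_poly n y) z =
      poly (smult (alternant n y) (\<Prod>i\<in>{1..n}. [:- y i, 1:])) z"
    by (simp add: poly_alternant_poly)
qed (rule degree_alternant_poly_le)

theorem alternant_eq_vandermonde:
  fixes y :: "nat \<Rightarrow> 'a::{idom, ring_char_0}"
  shows "alternant n y = vandermonde n y"
proof (induction n)
  case 0
  show ?case by (simp add: alternant_def vandermonde_def)
next
  case (Suc n)
  show ?case
  proof (cases "inj_on y {1..n}")
    case False
    then obtain a b where "a \<in> {1..n}" "b \<in> {1..n}" "a \<noteq> b" "y a = y b"
      by (auto simp: inj_on_def)
    then show ?thesis by (simp add: alternant_eq_0[of a _ b] vandermonde_eq_0[of a _ b])
  next
    case True
    have "alternant (Suc n) y = poly (alternant_poly n y) (y (Suc n))"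
      by (simp add: poly_alternant_poly)
    also have "\<dots> = vandermonde (Suc n) y"
      by (simp add: alternant_poly_eq[OF True] poly_prod Suc.IH vandermonde_Suc)
    finally show ?thesis .
  qed
qed

lemma vandermonde_permute:
  fixes y :: "nat \<Rightarrow> 'a::{idom, ring_char_0}"
  assumes "\<tau> permutes {1..n}"
  shows "vandermonde n (y \<circ> \<tau>) = of_int (sign \<tau>) * vandermonde n y"
  using alternant_permute[OF assms, of y] by (simp only: alternant_eq_vandermonde)

definition power_permanent :: "nat \<Rightarrow> (nat \<Rightarrow> 'a) \<Rightarrow> 'a::comm_ring_1"
  where "power_permanent n y = (\<Sum>\<sigma> | \<sigma> permutes {1..n}. \<Prod>i\<in>{1..n}. y i ^ (\<sigma> i - 1))"

lemma power_permanent_1: "power_permanent n (\<lambda>_. 1) = fact n"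
  by (simp add: power_permanent_def card_permutations)

lemma vandermonde_cong_power_permanent:
  fixes \<zeta> :: "nat \<Rightarrow> complex"
  assumes q: "q > 0" and roots: "\<And>i. i \<in> {1..n} \<Longrightarrow> \<zeta> i ^ q = 1"
  obtains \<beta> where "\<beta> \<in> cyclotomic_ints q" "vandermonde n \<zeta> = power_permanent n \<zeta> + 2 * \<beta>"
proof
  let ?\<beta> = "\<Sum>\<sigma> | \<sigma> permutes {1..n}. of_int ((sign \<sigma> - 1) div 2) * (\<Prod>i\<in>{1..n}. \<zeta> i ^ (\<sigma> i - 1))"
  have "(\<zeta> i ^ j) ^ q = 1" if "i \<in> {1..n}" for i j
    using roots[OF that] by (metis mult.commute power_mult power_one)
  then show "?\<beta> \<in> cyclotomic_ints q"
    by (intro cyclotomic_ints_sum cyclotomic_ints_of_int_mult cyclotomic_ints_prod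
        cyclotomic_ints_root q)
  have "alternant n \<zeta> = power_permanent n \<zeta> + 2 * ?\<beta>"
    unfolding alternant_def power_permanent_def sum.distrib[symmetric] sum_distrib_left
    by (rule sum.cong) (auto simp: sign_def)
  then show "vandermonde n \<zeta> = power_permanent n \<zeta> + 2 * ?\<beta>"
    by (simp only: alternant_eq_vandermonde)
qed

lemma vandermonde_roots_of_unity_odd_divisor:
  assumes "odd q" and roots: "\<And>i. i \<in> {1..n} \<Longrightarrow> \<zeta> i ^ q = 1" and inj: "inj_on \<zeta> {1..n}"
  shows "vandermonde n \<zeta> \<in> cyclotomic_odd_divisors q"
  unfolding vandermonde_def
  using odd_pos[OF \<open>odd q\<close>] \<open>odd q\<close> inj
  by (intro cyclotomic_odd_divisors_prod roots_of_unity_diff_odd_divisor)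
    (auto intro!: roots simp: inj_on_eq_iff)

theorem power_permanent_roots_of_unity_nonzero:
  fixes \<zeta> :: "nat \<Rightarrow> complex"
  assumes "odd q" "\<And>i. i \<in> {1..n} \<Longrightarrow> \<zeta> i ^ q = 1" "inj_on \<zeta> {1..n}"
  shows "power_permanent n \<zeta> \<noteq> 0"
proof
  assume zero: "power_permanent n \<zeta> = 0"
  have q: "q > 0" using assms(1) by (rule odd_pos)
  from vandermonde_cong_power_permanent[of q n \<zeta>, OF q assms(2)]
  obtain \<beta> where "\<beta> \<in> cyclotomic_ints q" "vandermonde n \<zeta> = 2 * \<beta>" unfolding zero by auto
  with twice_cyclotomic_int_not_odd_divisor[OF q, of \<beta>]
    vandermonde_roots_of_unity_odd_divisor[OF assms] show False by simp
qed

section \<open>Coefficients as averages over the discrete torus\<close>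

lemma sum_roots_of_unity_power:
  assumes M: "M > 0"
  shows "(\<Sum>z | z ^ M = 1. z ^ e) = (if M dvd e then of_nat M else (0::complex))"
proof (cases "M dvd e")
  case True
  then obtain k where "e = M * k" by blast
  then have "(\<Sum>z::complex | z ^ M = 1. z ^ e) = (\<Sum>z::complex | z ^ M = 1. 1)"
    by (intro sum.cong) (auto simp: power_mult)
  then show ?thesis using True M card_nth_roots[of 1 M] by simp
next
  case False
  define r where "r = e mod M"
  have r: "0 < r" "r < M" using False M by (auto simp: r_def dvd_eq_mod_eq_0)
  have "\<not> {z::complex. z ^ M = 1} \<subseteq> {z. z ^ r = 1}"
    using card_mono[OF finite_nth_roots[OF r(1), of 1], of "{z. z ^ M = 1}"] r
    by (auto simp: card_nth_roots)
  then obtain \<omega> :: complex where \<omega>: "\<omega> ^ M = 1" "\<omega> ^ r \<noteq> 1" by auto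
  have "\<omega> ^ e = \<omega> ^ (M * (e div M) + r)" by (simp add: r_def)
  then have "\<omega> ^ e \<noteq> 1" using \<omega> by (simp add: power_add power_mult)
  have "\<omega> \<noteq> 0" using \<omega>(1) M by (auto simp: power_0_left)
  then have "bij_betw (\<lambda>z. \<omega> * z) {z. z ^ M = 1} {z. z ^ M = 1}"
    using \<omega>(1) by (intro bij_betwI[where g = "\<lambda>z. z / \<omega>"]) (auto simp: power_mult_distrib power_divide)
  from sum.reindex_bij_betw[OF this, of "\<lambda>z. z ^ e"]
  have "(\<Sum>z | z ^ M = 1. z ^ e) = \<omega> ^ e * (\<Sum>z | z ^ M = 1. z ^ e)"
    by (simp add: power_mult_distrib sum_distrib_left)
  then show ?thesis using \<open>\<omega> ^ e \<noteq> 1\<close> False by simp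
qed

lemma sum_roots_of_unity_moment:
  assumes "K < M" "j < M"
  shows "(\<Sum>z | z ^ M = 1. z ^ (M - K) * z ^ j) = (if j = K then of_nat M else (0::complex))"
proof -
  have "M dvd M - K + j \<longleftrightarrow> j = K"
  proof
    assume "M dvd M - K + j"
    then obtain c where c: "M - K + j = M * c" by blast
    then have "M * c < M * 2" and "0 < M * c" using assms by linarith+
    then have "c = 1" by simp
    with c show "j = K" using assms by simp
  qed (use assms in simp)
  then show ?thesis using assms by (simp add: power_add[symmetric] sum_roots_of_unity_power)
qed

text \<open>The weight \<open>z ^ (M - K)\<close> is \<open>z\<close> to the power \<open>- K\<close> at an \<open>M\<close>th root of unity.\<close>

definition torus_coeff :: "'i set \<Rightarrow> nat \<Rightarrow> nat \<Rightarrow> (('i \<Rightarrow> complex) \<Rightarrow> complex) \<Rightarrow> complex"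
  where "torus_coeff I M K = grid_sum I (\<lambda>_. {z. z ^ M = 1}) (\<lambda>_ z. z ^ (M - K) / of_nat M)"

lemma torus_coeff_add:
  "torus_coeff I M K (\<lambda>x. f x + g x) = torus_coeff I M K f + torus_coeff I M K g"
  by (simp add: torus_coeff_def grid_sum_add)

lemma torus_coeff_cmult: "torus_coeff I M K (\<lambda>x. c * f x) = c * torus_coeff I M K f"
  by (simp add: torus_coeff_def grid_sum_cmult)

lemma torus_coeff_sum:
  "torus_coeff I M K (\<lambda>x. \<Sum>j\<in>J. f j x) = (\<Sum>j\<in>J. torus_coeff I M K (f j))"
  by (simp add: torus_coeff_def grid_sum_sum)

lemma coeff_weights_torus:
  assumes "K < M"
  shows "coeff_weights I (\<lambda>_. K) (\<lambda>_. {z::complex. z ^ M = 1}) (\<lambda>_ z. z ^ (M - K) / of_nat M)"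
proof -
  have "(\<Sum>z | z ^ M = 1. z ^ (M - K) / of_nat M * z ^ j) = (if j = K then 1 else (0::complex))"
    if "j \<le> K" for j
    using sum_roots_of_unity_moment[OF assms, of j] assms that
    by (simp add: sum_divide_distrib[symmetric])
  moreover have "finite {z::complex. z ^ M = 1}" using assms by (intro finite_nth_roots) simp
  ultimately show ?thesis by (simp add: coeff_weights_def)
qed

lemma torus_coeff_permute:
  assumes \<tau>: "\<tau> permutes I"
  shows "torus_coeff I M K (\<lambda>x. f (x \<circ> \<tau>)) = torus_coeff I M K f"
proof -
  let ?X = "PiE I (\<lambda>_. {z::complex. z ^ M = 1})"
  have closed: "x \<circ> \<rho> \<in> ?X" if "\<rho> permutes I" "x \<in> ?X" for \<rho> x
  proof (rule PiE_I)
    fix i assume "i \<in> I"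
    then show "(x \<circ> \<rho>) i \<in> {z. z ^ M = 1}"
      using permutes_in_image[OF that(1), of i] PiE_mem[OF that(2)] by auto
  next
    fix i assume "i \<notin> I"
    then show "(x \<circ> \<rho>) i = undefined"
      using permutes_not_in[OF that(1)] PiE_arb[OF that(2)] by auto
  qed
  have "bij_betw (\<lambda>x. x \<circ> \<tau>) ?X ?X"
    using closed[OF \<tau>] closed[OF permutes_inv[OF \<tau>]] permutes_inv_o[OF \<tau>]
    by (intro bij_betwI[where g = "\<lambda>x. x \<circ> inv \<tau>"]) (auto simp: comp_assoc)
  from sum.reindex_bij_betw[OF this, of "\<lambda>x. (\<Prod>i\<in>I. x i ^ (M - K) / of_nat M) * f x"]
  show ?thesis
    using prod.permute[OF \<tau>, of "\<lambda>i. x i ^ (M - K) / of_nat M" for x :: "_ \<Rightarrow> complex",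
        symmetric]
    by (simp add: torus_coeff_def grid_sum_def o_def)
qed

lemma mult_poly_pderiv:
  "x * poly (pderiv p) x = (\<Sum>j\<le>degree p. of_nat j * coeff p j * x ^ j)"
proof -
  have "x * (of_nat j * coeff p j * x ^ (j - 1)) = of_nat j * coeff p j * x ^ j" for j
    by (cases j) (simp_all add: mult_ac)
  moreover have "pderiv p = pderiv (\<Sum>j\<le>degree p. monom (coeff p j) j)"
    by (simp only: poly_as_sum_of_monoms)
  then have "pderiv p = (\<Sum>j\<le>degree p. monom (of_nat j * coeff p j) (j - 1))"
    using higher_pderiv_sum[of 1 "\<lambda>j. monom (coeff p j) j" "{..degree p}"]
    by (simp add: pderiv_monom)
  ultimately show ?thesis
    by (simp add: poly_sum poly_monom sum_distrib_left)
qed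

text \<open>
  The Euler operator \<open>z d/dz\<close> multiplies \<open>z ^ K\<close> by \<open>K\<close>, hence acts so on the extracted coefficient;
  this replaces integration by parts on the circle.
\<close>

lemma sum_roots_of_unity_euler_operator:
  assumes "K < M" "degree p < M"
  shows "(\<Sum>z | z ^ M = 1. z ^ (M - K) * (z * poly (pderiv p) z)) =
    of_nat K * (\<Sum>z | z ^ M = 1. z ^ (M - K) * poly p (z::complex))"
proof -
  let ?s = "\<lambda>j. \<Sum>z | z ^ M = 1. z ^ (M - K) * z ^ j :: complex"
  have "(\<Sum>z | z ^ M = 1. z ^ (M - K) * (z * poly (pderiv p) z)) =
    (\<Sum>j\<le>degree p. of_nat j * coeff p j * ?s j)"
    unfolding mult_poly_pderiv sum_distrib_left by (subst sum.swap) (simp add: mult_ac)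
  also have "\<dots> = (\<Sum>j\<le>degree p. of_nat K * (coeff p j * ?s j))"
    using assms by (intro sum.cong refl) (auto simp: sum_roots_of_unity_moment)
  also have "\<dots> = of_nat K * (\<Sum>z | z ^ M = 1. z ^ (M - K) * poly p z)"
    unfolding poly_altdef sum_distrib_left by (subst sum.swap) (simp add: mult_ac)
  finally show ?thesis .
qed

lemma torus_coeff_euler_operator:
  assumes J: "finite J" "b \<notin> J" and M: "K < M" "\<And>x. degree (p x) < M"
    and indep: "\<And>x z. p (x(b := z)) = p x"
  shows "torus_coeff (insert b J) M K (\<lambda>x. x b * poly (pderiv (p x)) (x b)) =
    of_nat K * torus_coeff (insert b J) M K (\<lambda>x. poly (p x) (x b))"
proof -
  have "torus_coeff (insert b J) M K f = torus_coeff J M K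
      (\<lambda>x. 1 / of_nat M * (\<Sum>z | z ^ M = 1. z ^ (M - K) * f (x(b := z))))" for f
    unfolding torus_coeff_def grid_sum_insert[OF J] sum_distrib_left by simp
  then have "torus_coeff (insert b J) M K f = 1 / of_nat M *
      torus_coeff J M K (\<lambda>x. \<Sum>z | z ^ M = 1. z ^ (M - K) * f (x(b := z)))" for f
    by (simp only: torus_coeff_cmult)
  then show ?thesis
    by (simp add: indep sum_roots_of_unity_euler_operator[OF M] torus_coeff_cmult)
qed

section \<open>Products of all differences\<close>

definition diff_prod :: "'i set \<Rightarrow> ('i \<Rightarrow> 'a) \<Rightarrow> 'a::comm_ring_1"
  where "diff_prod I x = (\<Prod>i\<in>I. \<Prod>j\<in>I - {i}. x i - x j)"

lemma diff_prod_insert: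
  assumes "finite I" "b \<notin> I"
  shows "diff_prod (insert b I) x = diff_prod I x * (\<Prod>j\<in>I. - ((x b - x j)\<^sup>2))"
proof -
  have remove: "insert b I - {i} = insert b (I - {i})" if "i \<in> I" for i
    using that assms by auto
  have square: "(x b - x j) * (x j - x b) = - ((x b - x j)\<^sup>2)" for j
    by (simp add: power2_eq_square algebra_simps)
  have "diff_prod (insert b I) x =
      (\<Prod>j\<in>I. x b - x j) * (\<Prod>i\<in>I. (x i - x b) * (\<Prod>j\<in>I - {i}. x i - x j))"
    using assms by (simp add: diff_prod_def remove)
  also have "\<dots> = diff_prod I x * (\<Prod>j\<in>I. (x b - x j) * (x j - x b))"
    by (simp add: diff_prod_def prod.distrib mult_ac)
  finally show ?thesis by (simp only: square)
qed

lemma diff_prod_permute: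
  assumes \<tau>: "\<tau> permutes I"
  shows "diff_prod I (x \<circ> \<tau>) = diff_prod I x"
proof -
  have "(\<Prod>j\<in>I - {i}. (x \<circ> \<tau>) i - (x \<circ> \<tau>) j) = (\<Prod>j\<in>I - {\<tau> i}. x (\<tau> i) - x j)" for i
  proof -
    have "bij_betw \<tau> (I - {i}) (I - {\<tau> i})"
      using permutes_image[OF \<tau>] image_set_diff[OF permutes_inj[OF \<tau>], of I "{i}"]
      by (auto intro!: bij_betw_imageI permutes_inj_on[OF \<tau>])
    from prod.reindex_bij_betw[OF this, of "\<lambda>j. x (\<tau> i) - x j"] show ?thesis by simp
  qed
  then show ?thesis
    using prod.permute[OF \<tau>, of "\<lambda>i. \<Prod>j\<in>I - {i}. x i - x j"] by (simp add: diff_prod_def o_def)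
qed

lemma diff_prod_eq_0:
  assumes "finite I" "i \<in> I" "j \<in> I" "i \<noteq> j" "x i = x j"
  shows "diff_prod I x = 0"
proof -
  have "(\<Prod>j\<in>I - {i}. x i - x j) = 0"
    using assms by (intro prod_zero bexI[of _ j]) auto
  then show ?thesis unfolding diff_prod_def using assms(1,2) by (metis (lifting) prod_zero)
qed

lemma diff_prod_eq_vandermonde: "diff_prod {1..n} x = (-1) ^ (n choose 2) * (vandermonde n x)\<^sup>2"
proof (induction n)
  case 0
  show ?case by (simp add: diff_prod_def vandermonde_def numeral_2_eq_2)
next
  case (Suc n)
  have "diff_prod {1..Suc n} x = diff_prod {1..n} x * (\<Prod>j\<in>{1..n}. - ((x (Suc n) - x j)\<^sup>2))"
    using diff_prod_insert[of "{1..n}" "Suc n" x] by (simp add: atLeastAtMostSuc_conv)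
  also have "\<dots> = (-1) ^ (n choose 2) * (-1) ^ n * (vandermonde n x * (\<Prod>j\<in>{1..n}. x (Suc n) - x j))\<^sup>2"
    unfolding Suc.IH by (simp add: prod_uminus prod_power_distrib power_mult_distrib mult_ac)
  finally show ?case
    by (simp add: vandermonde_Suc numeral_2_eq_2 power_add mult_ac)
qed

lemma unit_circle_diff_square:
  assumes "cmod u = 1" "cmod v = 1"
  shows "- ((u - v)\<^sup>2) = of_real ((cmod (u - v))\<^sup>2) * (u * v)"
proof -
  have unit: "u * cnj u = 1" "v * cnj v = 1"
    using assms complex_norm_square[of u] complex_norm_square[of v] by simp_all
  have "of_real ((cmod (u - v))\<^sup>2) * (u * v) = (u - v) * (cnj u - cnj v) * (u * v)"
    unfolding complex_norm_square by simp
  also have "\<dots> = (u - v) * ((u * cnj u) * v - (v * cnj v) * u)" by (simp add: algebra_simps)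
  also have "\<dots> = - ((u - v)\<^sup>2)" unfolding unit by (simp add: power2_eq_square algebra_simps)
  finally show ?thesis ..
qed

lemma unit_circle_diff_prod:
  assumes "finite I" "\<And>i. i \<in> I \<Longrightarrow> cmod (x i) = 1"
  shows "diff_prod I x = of_real (cmod (diff_prod I x)) * (\<Prod>i\<in>I. x i) ^ (card I - 1)"
  using assms
proof (induction I rule: finite_induct)
  case empty
  show ?case by (simp add: diff_prod_def)
next
  case (insert b I)
  let ?P = "\<Prod>i\<in>I. x i" and ?N = "\<Prod>j\<in>I. (cmod (x b - x j))\<^sup>2"
  have IH: "diff_prod I x = of_real (cmod (diff_prod I x)) * ?P ^ (card I - 1)"
    using insert.IH insert.prems by blast
  have "(\<Prod>j\<in>I. - ((x b - x j)\<^sup>2)) = (\<Prod>j\<in>I. of_real ((cmod (x b - x j))\<^sup>2) * (x b * x j))"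
    using insert.prems by (intro prod.cong refl unit_circle_diff_square) auto
  then have squares: "(\<Prod>j\<in>I. - ((x b - x j)\<^sup>2)) = of_real ?N * (x b ^ card I * ?P)"
    by (simp add: prod.distrib)
  have norm: "cmod (diff_prod (insert b I) x) = cmod (diff_prod I x) * ?N"
    using insert.hyps by (simp add: diff_prod_insert norm_mult norm_power prod_norm[symmetric])
  have power: "?P ^ (card I - 1) * ?P = ?P ^ card I"
    using insert.hyps by (cases "card I") auto
  have "diff_prod (insert b I) x =
      of_real (cmod (diff_prod I x)) * ?P ^ (card I - 1) * (of_real ?N * (x b ^ card I * ?P))"
    by (simp only: diff_prod_insert[OF insert.hyps] squares IH[symmetric])
  also have "\<dots> = of_real (cmod (diff_prod I x)) * of_real ?N * (x b ^ card I * (?P ^ (card I - 1) * ?P))"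
    by (simp only: mult_ac)
  also have "\<dots> = of_real (cmod (diff_prod (insert b I) x)) * (x b * ?P) ^ card I"
    by (simp only: norm power power_mult_distrib of_real_mult)
  finally show ?case using insert.hyps by simp
qed

section \<open>Aomoto's recurrence\<close>

definition aomoto :: "'i set \<Rightarrow> nat \<Rightarrow> 'i set \<Rightarrow> nat \<Rightarrow> ('i \<Rightarrow> complex) \<Rightarrow> complex"
  where "aomoto I m B L x = (\<Prod>i\<in>B. x i) * diff_prod I x ^ m * (\<Sum>i\<in>I. x i) ^ L"

lemma aomoto_permute:
  assumes \<tau>: "\<tau> permutes I" and B: "\<tau> ` B = B"
  shows "aomoto I m B L (x \<circ> \<tau>) = aomoto I m B L x"
proof -
  have "(\<Prod>i\<in>B. (x \<circ> \<tau>) i) = (\<Prod>i\<in>B. x i)"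
    using prod.reindex[OF permutes_inj_on[OF \<tau>], of x B] B by simp
  moreover have "(\<Sum>i\<in>I. (x \<circ> \<tau>) i) = (\<Sum>i\<in>I. x i)"
    using sum.permute[OF \<tau>, of x] by simp
  ultimately show ?thesis by (simp add: aomoto_def diff_prod_permute[OF \<tau>])
qed

definition aomoto_poly :: "'i set \<Rightarrow> nat \<Rightarrow> 'i set \<Rightarrow> nat \<Rightarrow> ('i \<Rightarrow> complex) \<Rightarrow> complex poly"
  where "aomoto_poly J m B L x = smult ((\<Prod>i\<in>B. x i) * (diff_prod J x * (-1) ^ card J) ^ m)
    ((\<Prod>j\<in>J. [:- x j, 1:] ^ (2 * m)) * [:\<Sum>i\<in>J. x i, 1:] ^ L)"

lemma aomoto_poly_fun_upd:
  assumes "b \<notin> J" "b \<notin> B"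
  shows "aomoto_poly J m B L (x(b := z)) = aomoto_poly J m B L x"
proof -
  have "diff_prod J (x(b := z)) = diff_prod J x"
    unfolding diff_prod_def using assms by (intro prod.cong refl) auto
  moreover have "(\<Prod>i\<in>B. (x(b := z)) i) = (\<Prod>i\<in>B. x i)" using assms by (intro prod.cong) auto
  moreover have "(\<Sum>i\<in>J. (x(b := z)) i) = (\<Sum>i\<in>J. x i)" using assms by (intro sum.cong) auto
  moreover have "(\<Prod>j\<in>J. [:- (x(b := z)) j, 1:] ^ (2 * m)) = (\<Prod>j\<in>J. [:- x j, 1:] ^ (2 * m))"
    using assms by (intro prod.cong) auto
  ultimately show ?thesis by (simp only: aomoto_poly_def)
qed

lemma degree_aomoto_poly_le: "degree (aomoto_poly J m B L x) \<le> 2 * m * card J + L"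
proof -
  have "degree (\<Prod>j\<in>J. [:- x j, 1:] ^ (2 * m)) = 2 * m * card J"
    by (subst degree_prod_sum_eq) (simp_all add: degree_linear_power)
  then have "degree ((\<Prod>j\<in>J. [:- x j, 1:] ^ (2 * m)) * [:\<Sum>i\<in>J. x i, 1:] ^ L) \<le> 2 * m * card J + L"
    by (metis degree_linear_power degree_mult_le)
  then show ?thesis
    unfolding aomoto_poly_def by (rule order_trans[OF degree_smult_le])
qed

lemma diff_prod_insert_power:
  assumes "finite J" "b \<notin> J"
  shows "diff_prod (insert b J) x ^ m =
    (diff_prod J x * (-1) ^ card J) ^ m * (\<Prod>j\<in>J. (x b - x j) ^ (2 * m))"
  by (simp add: diff_prod_insert[OF assms] prod_uminus power_mult_distrib power_mult
      prod_power_distrib[symmetric] mult.assoc)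

lemma poly_aomoto_poly:
  assumes "finite J" "b \<notin> J"
  shows "poly (aomoto_poly J m B L x) (x b) = aomoto (insert b J) m B L x"
  using assms
  by (simp add: aomoto_poly_def aomoto_def diff_prod_insert_power poly_prod mult_ac add_ac)

lemma poly_pderiv_prod_linear_powers:
  fixes y :: "'i \<Rightarrow> 'a::{field, ring_char_0}"
  assumes "finite J" "\<And>j. j \<in> J \<Longrightarrow> e j \<ge> 2"
  shows "poly (pderiv (\<Prod>j\<in>J. [:- y j, 1:] ^ e j)) t =
    (\<Sum>j\<in>J. of_nat (e j) * ((\<Prod>j\<in>J. (t - y j) ^ e j) / (t - y j)))"
proof -
  have "poly (pderiv (\<Prod>j\<in>J. [:- y j, 1:] ^ e j)) t =
    (\<Sum>a\<in>J. (\<Prod>j\<in>J - {a}. (t - y j) ^ e j) * (of_nat (e a) * (t - y a) ^ (e a - 1)))"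
    by (simp add: pderiv_prod poly_sum poly_prod pderiv_power pderiv_pCons mult_ac)
  also have "\<dots> = (\<Sum>j\<in>J. of_nat (e j) * ((\<Prod>j\<in>J. (t - y j) ^ e j) / (t - y j)))"
  proof (intro sum.cong refl)
    fix a assume a: "a \<in> J"
    have "(t - y a) ^ (e a - 1) = (t - y a) ^ e a / (t - y a)"
      using assms(2)[OF a] by (cases "t = y a") (auto simp: power_diff)
    then show "(\<Prod>j\<in>J - {a}. (t - y j) ^ e j) * (of_nat (e a) * (t - y a) ^ (e a - 1)) =
      of_nat (e a) * ((\<Prod>j\<in>J. (t - y j) ^ e j) / (t - y a))"
      using a assms(1) by (simp add: prod.remove[of J a] algebra_simps)
  qed
  finally show ?thesis .
qed

text \<open>
  Where \<open>x b = x j\<close>, the quotients below are \<open>0\<close> by convention. This agrees with the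
  polynomials they stand for, which contain the factor \<open>(x b - x j) ^ (2 * m - 1)\<close>.
\<close>

lemma mult_poly_pderiv_aomoto_poly:
  assumes J: "finite J" "b \<notin> J" and B: "finite B" "b \<notin> B" and m: "m > 0"
  shows "x b * poly (pderiv (aomoto_poly J m B L x)) (x b) =
    of_nat L * aomoto (insert b J) m (insert b B) (L - 1) x +
    (\<Sum>j\<in>J. of_nat (2 * m) * (aomoto (insert b J) m B L x * (x b / (x b - x j))))"
proof -
  define Q where "Q = (\<Prod>j\<in>J. [:- x j, 1:] ^ (2 * m))"
  define P where "P = (\<Prod>j\<in>J. (x b - x j) ^ (2 * m))"
  define s where "s = (\<Sum>i\<in>insert b J. x i)"
  define c where "c = (\<Prod>i\<in>B. x i) * (diff_prod J x * (-1) ^ card J) ^ m"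
  have cP: "c * P = (\<Prod>i\<in>B. x i) * diff_prod (insert b J) x ^ m"
    by (simp add: c_def P_def diff_prod_insert_power[OF J] mult.assoc)
  have Q: "poly Q (x b) = P" and sum: "x b + (\<Sum>i\<in>J. x i) = s"
    using J by (simp_all add: Q_def P_def s_def poly_prod)
  have pderivQ: "poly (pderiv Q) (x b) = (\<Sum>j\<in>J. of_nat (2 * m) * (P / (x b - x j)))"
    unfolding Q_def P_def using J m by (intro poly_pderiv_prod_linear_powers) auto
  have "x b * poly (pderiv (aomoto_poly J m B L x)) (x b) =
      of_nat L * (x b * (c * P) * s ^ (L - 1)) + x b * c * s ^ L * poly (pderiv Q) (x b)"
    unfolding aomoto_poly_def c_def[symmetric] Q_def[symmetric]
    by (simp add: pderiv_smult pderiv_mult pderiv_power pderiv_pCons Q sum add.commute algebra_simps)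
  also have "x b * c * s ^ L * poly (pderiv Q) (x b) =
      (\<Sum>j\<in>J. of_nat (2 * m) * (c * P * s ^ L * (x b / (x b - x j))))"
    unfolding pderivQ by (simp add: sum_distrib_left algebra_simps)
  finally show ?thesis
    unfolding cP using B by (simp add: aomoto_def s_def algebra_simps)
qed

lemma aomoto_integration_by_parts:
  assumes J: "finite J" "b \<notin> J" and B: "finite B" "b \<notin> B" and m: "m > 0"
    and M: "K < M" "2 * m * card J + L < M"
  shows "of_nat K * torus_coeff (insert b J) M K (aomoto (insert b J) m B L) =
    of_nat L * torus_coeff (insert b J) M K (aomoto (insert b J) m (insert b B) (L - 1)) +
    (\<Sum>j\<in>J. of_nat (2 * m) *
      torus_coeff (insert b J) M K (\<lambda>x. aomoto (insert b J) m B L x * (x b / (x b - x j))))"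
proof -
  have "degree (aomoto_poly J m B L x) < M" for x
    using degree_aomoto_poly_le M(2) by (rule le_less_trans)
  from torus_coeff_euler_operator[OF J M(1) this aomoto_poly_fun_upd[OF J(2) B(2)]]
  show ?thesis
    unfolding mult_poly_pderiv_aomoto_poly[OF J B m] poly_aomoto_poly[OF J]
      torus_coeff_add torus_coeff_cmult torus_coeff_sum
    by (rule sym)
qed

lemma torus_coeff_symmetrize:
  assumes "\<tau> permutes I"
  shows "torus_coeff I M K (\<lambda>x. f x + f (x \<circ> \<tau>)) = 2 * torus_coeff I M K f"
  by (simp add: torus_coeff_add torus_coeff_permute[OF assms, of M K f])

lemma torus_coeff_aomoto_quotient_inside:
  assumes "finite B" "B \<subseteq> I" "b \<in> I" "b \<notin> B" "j \<in> B"
  shows "torus_coeff I M K (\<lambda>x. aomoto I m B L x * (x b / (x b - x j))) = 0"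
proof -
  let ?h = "\<lambda>x. aomoto I m B L x * (x b / (x b - x j))"
  let ?\<tau> = "transpose b j"
  have \<tau>: "?\<tau> permutes I" "?\<tau> ` insert b B = insert b B"
    using assms permutes_image[OF permutes_swap_id[of b "insert b B" j]]
    by (auto intro!: permutes_swap_id)
  have h: "?h x = aomoto I m (insert b B) L x / (x b - x j)" for x
    using assms by (simp add: aomoto_def)
  have "?h x + ?h (x \<circ> ?\<tau>) = 0" for x
    unfolding h aomoto_permute[OF \<tau>]
    using minus_divide_right[of "aomoto I m (insert b B) L x" "x b - x j"]
    by (simp add: add_eq_0_iff)
  then show ?thesis
    using torus_coeff_symmetrize[OF \<tau>(1), of M K ?h] torus_coeff_cmult[of I M K 0] by simp
qed

lemma torus_coeff_aomoto_quotient_outside: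
  assumes "finite I" "b \<in> I" "b \<notin> B" "j \<in> I" "j \<notin> B" "j \<noteq> b" "m > 0"
  shows "2 * torus_coeff I M K (\<lambda>x. aomoto I m B L x * (x b / (x b - x j))) =
    torus_coeff I M K (aomoto I m B L)"
proof -
  let ?h = "\<lambda>x. aomoto I m B L x * (x b / (x b - x j))"
  let ?\<tau> = "transpose b j"
  have \<tau>: "?\<tau> permutes I" "?\<tau> ` B = B"
    using assms by (auto intro!: permutes_swap_id simp: transpose_image_eq)
  have "?h x + ?h (x \<circ> ?\<tau>) = aomoto I m B L x" for x
  proof (cases "x b = x j")
    case True
    then show ?thesis using diff_prod_eq_0[of I b j x] assms by (simp add: aomoto_def)
  next
    case False
    then have "x b / (x b - x j) + x j / (x j - x b) = 1"
      by (simp add: divide_simps) (simp add: algebra_simps)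
    moreover have "?h x + ?h (x \<circ> ?\<tau>) =
        aomoto I m B L x * (x b / (x b - x j) + x j / (x j - x b))"
      unfolding aomoto_permute[OF \<tau>] distrib_left by simp
    ultimately show ?thesis by simp
  qed
  then show ?thesis using torus_coeff_symmetrize[OF \<tau>(1), of M K ?h] by simp
qed

theorem aomoto_recurrence:
  assumes I: "finite I" and B: "B \<subseteq> I" and b: "b \<in> I" "b \<notin> B" and m: "m > 0"
    and M: "K < M" "2 * m * card I + L < M"
  shows "(of_nat K - of_nat (m * card (I - insert b B))) * torus_coeff I M K (aomoto I m B L) =
    of_nat L * torus_coeff I M K (aomoto I m (insert b B) (L - 1))"
proof -
  let ?T = "torus_coeff I M K"
  let ?quotient = "\<lambda>j. ?T (\<lambda>x. aomoto I m B L x * (x b / (x b - x j)))"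
  have fin: "finite B" using I B by (rule finite_subset[rotated])
  have "card (I - {b}) \<le> card I" using I by (simp add: card_Diff1_le)
  then have "2 * m * card (I - {b}) + L < M"
    using M(2) by (meson add_le_mono1 le_less_trans mult_le_mono2)
  from aomoto_integration_by_parts[OF _ _ fin b(2) m M(1) this] I b
  have parts: "of_nat K * ?T (aomoto I m B L) =
      of_nat L * ?T (aomoto I m (insert b B) (L - 1)) + (\<Sum>j\<in>I - {b}. of_nat (2 * m) * ?quotient j)"
    by (simp add: insert_absorb)
  have "(\<Sum>j\<in>I - {b}. of_nat (2 * m) * ?quotient j) =
    (\<Sum>j\<in>I - insert b B. of_nat (2 * m) * ?quotient j)"
    using I torus_coeff_aomoto_quotient_inside[OF fin B b]
    by (intro sum.mono_neutral_right) auto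
  also have "\<dots> = (\<Sum>j\<in>I - insert b B. of_nat m * ?T (aomoto I m B L))"
    using torus_coeff_aomoto_quotient_outside[OF I b _ _ _ m, of _ M K L]
    by (intro sum.cong refl) (simp add: mult.commute[of 2] mult.assoc)
  also have "\<dots> = of_nat (m * card (I - insert b B)) * ?T (aomoto I m B L)" by simp
  finally show ?thesis using parts by (simp add: algebra_simps)
qed

lemma torus_coeff_aomoto_full:
  assumes "K < M"
  shows "torus_coeff I M (Suc K) (aomoto I m I L) = torus_coeff I M K (aomoto I m {} L)"
proof -
  have "z ^ (M - Suc K) / of_nat M * z = z ^ (M - K) / (of_nat M :: complex)" for z
    unfolding Suc_diff_Suc[OF assms, symmetric] by simp
  then have "(\<Prod>i\<in>I. x i ^ (M - Suc K) / of_nat M) * (\<Prod>i\<in>I. x i) =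
      (\<Prod>i\<in>I. x i ^ (M - K) / (of_nat M :: complex))" for x
    by (simp only: prod.distrib[symmetric])
  then show ?thesis
    by (simp add: torus_coeff_def grid_sum_def aomoto_def mult.assoc[symmetric])
qed

lemma torus_weights_mult_aomoto:
  assumes M: "m * (card I - 1) \<le> M" and I: "finite I" "\<And>i. i \<in> I \<Longrightarrow> x i ^ M = 1 \<and> cmod (x i) = 1"
  shows "(\<Prod>i\<in>I. x i ^ (M - m * (card I - 1)) / of_nat M) * aomoto I m {} 0 x =
    of_real (cmod (diff_prod I x) ^ m / of_nat M ^ card I)"
proof -
  let ?E = "m * (card I - 1)" and ?P = "\<Prod>i\<in>I. x i"
  have "diff_prod I x ^ m = (of_real (cmod (diff_prod I x)) * ?P ^ (card I - 1)) ^ m"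
    using unit_circle_diff_prod[of I x] I by simp
  then have "(\<Prod>i\<in>I. x i ^ (M - ?E)) * diff_prod I x ^ m =
      of_real (cmod (diff_prod I x)) ^ m * (?P ^ (M - ?E) * ?P ^ ?E)"
    by (simp add: prod_power_distrib[symmetric] power_mult_distrib power_mult[symmetric] mult_ac)
  also have "?P ^ (M - ?E) * ?P ^ ?E = (\<Prod>i\<in>I. x i ^ M)"
    unfolding power_add[symmetric] using M by (simp add: prod_power_distrib)
  also have "\<dots> = 1" using I by (intro prod.neutral) auto
  finally show ?thesis by (simp add: aomoto_def prod_dividef)
qed

lemma torus_coeff_diff_prod_power_nonzero:
  assumes I: "finite I" and M: "m * (card I - 1) \<le> M" "card I \<le> M" "0 < M"
  shows "torus_coeff I M (m * (card I - 1)) (aomoto I m {} 0) \<noteq> 0"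
proof -
  let ?U = "{z::complex. z ^ M = 1}"
  let ?X = "PiE I (\<lambda>_. ?U)"
  have U: "finite ?U" "card ?U = M" using M by (auto simp: card_nth_roots finite_nth_roots)
  have "x i ^ M = 1 \<and> cmod (x i) = 1" if "x \<in> ?X" "i \<in> I" for x i
    using PiE_mem[OF that] M by (auto dest: power_eq_1_iff)
  then have "torus_coeff I M (m * (card I - 1)) (aomoto I m {} 0) =
      (\<Sum>x\<in>?X. of_real (cmod (diff_prod I x) ^ m / of_nat M ^ card I))"
    unfolding torus_coeff_def grid_sum_def by (intro sum.cong refl torus_weights_mult_aomoto M(1) I)
  moreover have "0 < (\<Sum>x\<in>?X. cmod (diff_prod I x) ^ m / of_nat M ^ card I)"
  proof -
    obtain x\<^sub>0 where x\<^sub>0: "x\<^sub>0 ` I \<subseteq> ?U" "inj_on x\<^sub>0 I"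
      using card_le_inj[OF I U(1)] U(2) M by auto
    have "restrict x\<^sub>0 I \<in> ?X" using x\<^sub>0 by auto
    moreover have "diff_prod I (restrict x\<^sub>0 I) \<noteq> 0"
      using x\<^sub>0 I by (auto simp: diff_prod_def inj_on_def)
    then have "0 < cmod (diff_prod I (restrict x\<^sub>0 I)) ^ m / real M ^ card I" using M by simp
    ultimately show ?thesis using I U by (intro sum_pos2[of ?X "restrict x\<^sub>0 I"] finite_PiE) auto
  qed
  ultimately show ?thesis by (simp only: of_real_sum[symmetric] of_real_eq_0_iff)
qed

lemma torus_coeff_aomoto_eq_0_extend:
  assumes I: "finite I" and m: "m > 0" and M: "K < M" "2 * m * card I + L < M" and L: "card I \<le> L"
    and zero: "torus_coeff I M K (aomoto I m {} L) = 0" and B: "B \<subseteq> I"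
  shows "torus_coeff I M K (aomoto I m B (L - card B)) = 0"
  using finite_subset[OF B I] B
proof (induction B rule: finite_induct)
  case empty
  show ?case using zero by simp
next
  case (insert b B)
  have "card B < card I" using insert I by (intro psubset_card_mono) auto
  then have "of_nat (L - card B) \<noteq> (0::complex)" using L unfolding of_nat_eq_0_iff by simp
  moreover have "of_nat (L - card B) *
      torus_coeff I M K (aomoto I m (insert b B) (L - card B - 1)) = 0"
    using insert I m M by (subst aomoto_recurrence[symmetric]) auto
  ultimately show ?case using insert.hyps by simp
qed

theorem torus_coeff_aomoto_nonzero:
  assumes I: "finite I" "I \<noteq> {}" and m: "m > 0"
    and M: "d + m * (card I - 1) < M" "2 * m * card I + card I * d < M"
  shows "torus_coeff I M (d + m * (card I - 1)) (aomoto I m {} (card I * d)) \<noteq> 0"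
  using M
proof (induction d)
  case 0
  have "1 * card I \<le> 2 * m * card I" using m by (intro mult_le_mono1) simp
  with 0 have "card I \<le> M" by linarith
  with 0 show ?case
    using torus_coeff_diff_prod_power_nonzero[OF I(1), of m M] by (simp add: mult_ac)
next
  case (Suc d)
  let ?K = "d + m * (card I - 1)" and ?L = "card I * Suc d"
  have "torus_coeff I M (Suc ?K) (aomoto I m I (?L - card I)) \<noteq> 0"
    using Suc torus_coeff_aomoto_full[of ?K M I m] by simp
  moreover have "torus_coeff I M (Suc ?K) (aomoto I m I (?L - card I)) = 0"
    if "torus_coeff I M (Suc ?K) (aomoto I m {} ?L) = 0"
    using that Suc.prems by (intro torus_coeff_aomoto_eq_0_extend[OF I(1) m]) auto
  ultimately show ?case by auto
qed

section \<open>Coefficients of twisted Vandermonde products\<close>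

lemma torus_coeff_twisted_vandermonde:
  assumes alt: "\<And>\<sigma> x. \<sigma> permutes {1..n} \<Longrightarrow> f (x \<circ> \<sigma>) = of_int (sign \<sigma>) * f x"
  shows "torus_coeff {1..n} M K (\<lambda>x. vandermonde n (\<lambda>i. \<zeta> i * x i) * f x) =
    power_permanent n \<zeta> * torus_coeff {1..n} M K (\<lambda>x. (\<Prod>i\<in>{1..n}. x i ^ (i - 1)) * f x)"
proof -
  let ?T = "torus_coeff {1..n} M K" and ?S = "{\<sigma>. \<sigma> permutes {1..n}}"
  define z where "z \<sigma> = (\<Prod>i\<in>{1..n}. \<zeta> i ^ (\<sigma> i - 1))" for \<sigma> :: "nat \<Rightarrow> nat"
  define F where "F \<sigma> x = (\<Prod>i\<in>{1..n}. x i ^ (\<sigma> i - 1)) * f x" for \<sigma> :: "nat \<Rightarrow> nat" and x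
  have F: "of_int (sign \<sigma>) * ?T (F \<sigma>) = ?T (F id)" if \<sigma>: "\<sigma> permutes {1..n}" for \<sigma>
  proof -
    have "F \<sigma> (x \<circ> \<sigma>) = of_int (sign \<sigma>) * F id x" for x
      using prod.permute[OF \<sigma>, of "\<lambda>i. x i ^ (i - 1)", unfolded o_def]
      by (simp add: F_def alt[OF \<sigma>])
    then have "?T (F \<sigma>) = of_int (sign \<sigma>) * ?T (F id)"
      using torus_coeff_permute[OF \<sigma>, of M K "F \<sigma>"] by (simp add: torus_coeff_cmult)
    then have "of_int (sign \<sigma>) * ?T (F \<sigma>) = of_int (sign \<sigma> * sign \<sigma>) * ?T (F id)"
      by (simp only: of_int_mult mult.assoc)
    then show ?thesis by simp
  qed
  have "vandermonde n (\<lambda>i. \<zeta> i * x i) * f x = (\<Sum>\<sigma>\<in>?S. z \<sigma> * (of_int (sign \<sigma>) * F \<sigma> x))" for x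
    unfolding alternant_eq_vandermonde[symmetric] alternant_def F_def z_def sum_distrib_right
    by (intro sum.cong refl) (simp add: power_mult_distrib prod.distrib mult_ac)
  then have "?T (\<lambda>x. vandermonde n (\<lambda>i. \<zeta> i * x i) * f x) =
      (\<Sum>\<sigma>\<in>?S. z \<sigma> * (of_int (sign \<sigma>) * ?T (F \<sigma>)))"
    by (simp only: torus_coeff_add torus_coeff_cmult torus_coeff_sum)
  also have "\<dots> = (\<Sum>\<sigma>\<in>?S. z \<sigma> * ?T (F id))"
    using F by (intro sum.cong refl) simp
  finally show ?thesis by (simp add: sum_distrib_right power_permanent_def z_def F_def[abs_def])
qed

lemma torus_coeff_twisted_vandermonde_nonzero_iff:
  assumes alt: "\<And>\<sigma> x. \<sigma> permutes {1..n} \<Longrightarrow> f (x \<circ> \<sigma>) = of_int (sign \<sigma>) * f x"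
    and \<zeta>: "power_permanent n \<zeta> \<noteq> 0"
  shows "torus_coeff {1..n} M K (\<lambda>x. vandermonde n (\<lambda>i. \<zeta> i * x i) * f x) \<noteq> 0 \<longleftrightarrow>
    torus_coeff {1..n} M K (\<lambda>x. vandermonde n x * f x) \<noteq> 0"
  using torus_coeff_twisted_vandermonde[OF alt, where M = M and K = K and \<zeta> = \<zeta>]
    torus_coeff_twisted_vandermonde[OF alt, where M = M and K = K and \<zeta> = "\<lambda>_. 1"] \<zeta>
  by (simp add: power_permanent_1)

theorem torus_coeff_twisted_vandermonde_power_nonzero:
  assumes n: "n > 0" and m: "m > 0" and \<zeta>: "power_permanent n \<zeta> \<noteq> 0"
    and M: "d + m * (n - 1) < M" "2 * m * n + n * d < M"
  shows "torus_coeff {1..n} M (d + m * (n - 1)) (\<lambda>x. vandermonde n (\<lambda>i. \<zeta> i * x i) *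
    vandermonde n x ^ (2 * m - 1) * (\<Sum>i\<in>{1..n}. x i) ^ (n * d)) \<noteq> 0"
proof -
  let ?T = "torus_coeff {1..n} M (d + m * (n - 1))"
  define f where "f x = vandermonde n x ^ (2 * m - 1) * (\<Sum>i\<in>{1..n}. x i) ^ (n * d)"
    for x :: "nat \<Rightarrow> complex"
  have alt: "f (x \<circ> \<sigma>) = of_int (sign \<sigma>) * f x" if \<sigma>: "\<sigma> permutes {1..n}" for \<sigma> x
  proof -
    have "sign \<sigma> ^ (2 * m - 1) = sign \<sigma>" using m by (auto simp: sign_def)
    then have "vandermonde n (x \<circ> \<sigma>) ^ (2 * m - 1) = of_int (sign \<sigma>) * vandermonde n x ^ (2 * m - 1)"
      by (simp add: vandermonde_permute[OF \<sigma>] power_mult_distrib flip: of_int_power)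
    then show ?thesis using sum.permute[OF \<sigma>, of x] by (simp add: f_def)
  qed
  have "aomoto {1..n} m {} (n * d) = (\<lambda>x. (-1) ^ ((n choose 2) * m) * (vandermonde n x * f x))"
  proof
    fix x :: "nat \<Rightarrow> complex"
    have "((vandermonde n x)\<^sup>2) ^ m = vandermonde n x * vandermonde n x ^ (2 * m - 1)"
      using m by (simp add: power_mult[symmetric] flip: power_Suc)
    then show "aomoto {1..n} m {} (n * d) x = (-1) ^ ((n choose 2) * m) * (vandermonde n x * f x)"
      unfolding aomoto_def diff_prod_eq_vandermonde f_def by (simp add: power_mult_distrib power_mult)
  qed
  then have "?T (aomoto {1..n} m {} (n * d)) =
      (-1) ^ ((n choose 2) * m) * ?T (\<lambda>x. vandermonde n x * f x)"
    by (simp only: torus_coeff_cmult)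
  then have "?T (\<lambda>x. vandermonde n x * f x) \<noteq> 0"
    using torus_coeff_aomoto_nonzero[of "{1..n}" m d M] n m M by auto
  then have "?T (\<lambda>x. vandermonde n (\<lambda>i. \<zeta> i * x i) * f x) \<noteq> 0"
    using torus_coeff_twisted_vandermonde_nonzero_iff[OF alt \<zeta>] by blast
  then show ?thesis by (simp add: f_def mult.assoc)
qed

section \<open>The restricted sumset\<close>

text \<open>
  The factor \<open>(x j - x i) ^ (2 * m - 1 - card (S i j))\<close> makes the leading form independent of the sizes
  of the sets \<open>S i j\<close>.
\<close>

definition restriction_poly ::
    "nat \<Rightarrow> nat \<Rightarrow> (nat \<Rightarrow> 'a) \<Rightarrow> (nat \<Rightarrow> nat \<Rightarrow> 'a set) \<Rightarrow> (nat \<Rightarrow> 'a) \<Rightarrow> 'a::comm_ring_1"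
  where "restriction_poly n m \<zeta> S x = (\<Prod>j\<in>{1..n}. \<Prod>i\<in>{1..<j}. (\<zeta> j * x j - \<zeta> i * x i) *
    ((x j - x i) ^ (2 * m - 1 - card (S i j)) * (\<Prod>s\<in>S i j. x j - x i + s)))"

lemma has_leading_form_restriction_factor:
  assumes ij: "i \<in> I" "j \<in> I" and I: "finite I" and m: "m > 0"
    and S: "finite S" "card S \<le> 2 * m - 1"
  shows "has_leading_form I (2 * m)
    (\<lambda>x. (u * x j - v * x i) * ((x j - x i) ^ (2 * m - 1 - card S) * (\<Prod>s\<in>S. x j - x i + s)))
    (\<lambda>x. (u * x j - v * x i) * (x j - x i) ^ (2 * m - 1))"
proof -
  have diff: "has_leading_form I 1 (\<lambda>x. x j - x i) (\<lambda>x. x j - x i)"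
    using has_leading_form_diff_vars[OF I ij(2,1), of 1 1] by simp
  have "has_leading_form I (\<Sum>s\<in>S. 1) (\<lambda>x. \<Prod>s\<in>S. x j - x i + s) (\<lambda>x. \<Prod>s\<in>S. x j - x i)"
    using has_leading_form_add_const[OF diff] by (intro has_leading_form_prod S) simp
  from has_leading_form_mult[OF has_leading_form_diff_vars[OF I ij(2,1), of u v]
      has_leading_form_mult[OF has_leading_form_power[OF diff, of "2 * m - 1 - card S"] this]]
  show ?thesis using m S(2) by (simp add: power_add[symmetric])
qed

lemma has_leading_form_restriction_poly:
  assumes m: "m > 0"
    and S: "\<And>i j. 1 \<le> i \<Longrightarrow> i < j \<Longrightarrow> j \<le> n \<Longrightarrow> finite (S i j) \<and> card (S i j) \<le> 2 * m - 1"
  shows "has_leading_form {1..n} (m * (n - 1) * n) (restriction_poly n m \<zeta> S)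
    (\<lambda>x. vandermonde n (\<lambda>i. \<zeta> i * x i) * vandermonde n x ^ (2 * m - 1))"
proof -
  have "has_leading_form {1..n} (\<Sum>j\<in>{1..n}. \<Sum>i\<in>{1..<j}. 2 * m) (restriction_poly n m \<zeta> S)
    (\<lambda>x. \<Prod>j\<in>{1..n}. \<Prod>i\<in>{1..<j}. (\<zeta> j * x j - \<zeta> i * x i) * (x j - x i) ^ (2 * m - 1))"
    unfolding restriction_poly_def using m S
    by (intro has_leading_form_prod has_leading_form_restriction_factor) auto
  moreover have "(\<Sum>j\<in>{1..n}. \<Sum>i\<in>{1..<j}. 2 * m) = m * (n - 1) * n"
    by (induction n) (auto simp: algebra_simps)
  ultimately show ?thesis
    by (simp add: vandermonde_def prod.distrib prod_power_distrib)
qed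

lemma restriction_poly_nonzero:
  assumes "restriction_poly n m \<zeta> S a \<noteq> 0" and ij: "1 \<le> i" "i < j" "j \<le> n" and S: "finite (S i j)"
  shows "a i * \<zeta> i \<noteq> a j * \<zeta> j \<and> a i - a j \<notin> S i j"
proof -
  have "(\<zeta> j * a j - \<zeta> i * a i) *
      ((a j - a i) ^ (2 * m - 1 - card (S i j)) * (\<Prod>s\<in>S i j. a j - a i + s)) \<noteq> 0"
    using assms(1) ij unfolding restriction_poly_def by (metis (no_types, lifting) atLeastAtMost_iff
      atLeastLessThan_iff finite_atLeastAtMost finite_atLeastLessThan le_trans less_imp_le prod_zero)
  then have "\<zeta> j * a j \<noteq> \<zeta> i * a i" and prod: "(\<Prod>s\<in>S i j. a j - a i + s) \<noteq> 0" by auto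
  moreover have "a i - a j \<notin> S i j"
  proof
    assume "a i - a j \<in> S i j"
    with S have "(\<Prod>s\<in>S i j. a j - a i + s) = 0" by (intro prod_zero bexI[of _ "a i - a j"]) auto
    with prod show False ..
  qed
  ultimately show ?thesis by (simp add: mult.commute)
qed

lemma finite_restricted_sums:
  assumes "finite I" "\<And>i. i \<in> I \<Longrightarrow> finite (A i)"
  shows "finite {\<Sum>i\<in>I. a i | a. (\<forall>i\<in>I. a i \<in> A i) \<and> P a}"
proof (rule finite_subset)
  show "{\<Sum>i\<in>I. a i | a. (\<forall>i\<in>I. a i \<in> A i) \<and> P a} \<subseteq> (\<lambda>a. \<Sum>i\<in>I. a i) ` PiE I A"
  proof safe
    fix a assume "\<forall>i\<in>I. a i \<in> A i"
    then show "(\<Sum>i\<in>I. a i) \<in> (\<lambda>a. \<Sum>i\<in>I. a i) ` PiE I A"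
      by (intro image_eqI[of _ _ "restrict a I"]) auto
  qed
  show "finite ((\<lambda>a. \<Sum>i\<in>I. a i) ` PiE I A)"
    using assms by (intro finite_imageI finite_PiE)
qed

theorem card_restricted_sums_gt:
  fixes A :: "nat \<Rightarrow> complex set"
  assumes n: "n > 0" and m: "m > 0" and \<zeta>: "power_permanent n \<zeta> \<noteq> 0"
    and A: "\<And>i. i \<in> {1..n} \<Longrightarrow> finite (A i) \<and> card (A i) = Suc (d + m * (n - 1))"
    and S: "\<And>i j. 1 \<le> i \<Longrightarrow> i < j \<Longrightarrow> j \<le> n \<Longrightarrow> finite (S i j) \<and> card (S i j) \<le> 2 * m - 1"
  shows "n * d < card {\<Sum>i = 1..n. a i | a. (\<forall>i\<in>{1..n}. a i \<in> A i) \<and>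
    (\<forall>i j. 1 \<le> i \<and> i < j \<and> j \<le> n \<longrightarrow> a i * \<zeta> i \<noteq> a j * \<zeta> j \<and> a i - a j \<notin> S i j)}"
    (is "_ < card ?X")
proof -
  define K where "K = d + m * (n - 1)"
  define M where "M = Suc (K + 2 * m * n + n * d)"
  have "torus_coeff {1..n} M K (\<lambda>x. vandermonde n (\<lambda>i. \<zeta> i * x i) *
    vandermonde n x ^ (2 * m - 1) * (\<Sum>i\<in>{1..n}. x i) ^ (n * d)) \<noteq> 0"
    unfolding K_def using n m \<zeta>
    by (intro torus_coeff_twisted_vandermonde_power_nonzero) (auto simp: M_def K_def)
  moreover have "m * (n - 1) * n + n * d = (\<Sum>i\<in>{1..n}. K)" by (simp add: K_def algebra_simps)
  moreover have "coeff_weights {1..n} (\<lambda>_. K) (\<lambda>_. {z::complex. z ^ M = 1})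
      (\<lambda>_ z. z ^ (M - K) / of_nat M)"
    by (intro coeff_weights_torus) (simp add: M_def)
  ultimately have "n * d <
      card ((\<lambda>a. \<Sum>i\<in>{1..n}. a i) ` {a \<in> PiE {1..n} A. restriction_poly n m \<zeta> S a \<noteq> 0})"
    unfolding torus_coeff_def using A has_leading_form_restriction_poly[OF m S]
    by (intro polynomial_method_card_sums[where K = "\<lambda>_. K"]) (auto simp: K_def)
  also have "\<dots> \<le> card ?X"
  proof (rule card_mono)
    show "finite ?X" using A by (intro finite_restricted_sums) auto
    show "(\<lambda>a. \<Sum>i\<in>{1..n}. a i) ` {a \<in> PiE {1..n} A. restriction_poly n m \<zeta> S a \<noteq> 0} \<subseteq> ?X"
      using restriction_poly_nonzero[of n m \<zeta> S] S by blast
  qed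
  finally show ?thesis .
qed

theorem theorem1p2:
  fixes k m n q :: nat
    and A :: "nat \<Rightarrow> complex set"
    and S :: "nat \<Rightarrow> nat \<Rightarrow> complex set"
    and \<zeta> :: "nat \<Rightarrow> complex"
  assumes "k > 0" and "m > 0" and "n > 0"
    and "\<And>i. i \<in> {1..n} \<Longrightarrow> finite (A i) \<and> card (A i) = k"
    and "\<And>i j. 1 \<le> i \<Longrightarrow> i < j \<Longrightarrow> j \<le> n \<Longrightarrow> finite (S i j) \<and> card (S i j) \<le> 2 * m - 1"
    and "q > 0" and "odd q"
    and "\<And>i. i \<in> {1..n} \<Longrightarrow> \<zeta> i ^ q = 1"
    and "inj_on \<zeta> {1..n}"
  shows "int (card {\<Sum>i = 1..n. a i | a.
            (\<forall>i \<in> {1..n}. a i \<in> A i) \<and>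
            (\<forall>i j. 1 \<le> i \<and> i < j \<and> j \<le> n \<longrightarrow>
               a i * \<zeta> i \<noteq> a j * \<zeta> j \<and> a i - a j \<notin> S i j)})
         \<ge> (int k - 1 - int m * (int n - 1)) * int n + 1"
    (is "int (card ?X) \<ge> _")
proof (cases "k - 1 < m * (n - 1)")
  case True
  then have "int (k - 1) < int (m * (n - 1))" by (simp only: of_nat_less_iff)
  then have "int k - 1 - int m * (int n - 1) < 0"
    using assms(1,3) by (simp add: of_nat_diff)
  then have "(int k - 1 - int m * (int n - 1)) * int n < 0"
    using assms(3) by (simp add: mult_neg_pos)
  then show ?thesis by linarith
next
  case False
  define d where "d = k - 1 - m * (n - 1)"
  have k: "k = Suc (d + m * (n - 1))" using False assms(1) by (simp add: d_def)
  then have d: "int d = int k - 1 - int m * (int n - 1)"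
    using assms(3) by (simp add: of_nat_diff)
  have "power_permanent n \<zeta> \<noteq> 0"
    using power_permanent_roots_of_unity_nonzero assms(7-9) by blast
  then have "n * d < card ?X"
    using assms(3,2) assms(4)[unfolded k] assms(5) by (intro card_restricted_sums_gt)
  then have "int (n * d) + 1 \<le> int (card ?X)" by linarith
  then show ?thesis unfolding d[symmetric] by (simp add: mult.commute)
qed

end
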